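(* Let $r,s\ge1$, $f\in\mathfrak{p}_r$ and $g\in\mathfrak{p}_s$. Then the Ihara bracket is, up to a global sign, the signed sum over the dihedral symmetry group: $$\{f,g\}=-\sum_{\mu\in D_{r+s+1}}\varepsilon(\mu)\,\mu\big(f(y_0,y_1,\ldots,y_r)\,g(y_r,y_{r+1},\ldots,y_{r+s})\big).$$ In particular, $\{\,,\}:\mathfrak{p}_r\times\mathfrak{p}_s\to\mathfrak{p}_{r+s}$, and $\mathfrak{p}=\bigoplus_{r\ge1}\mathfrak{p}_r$ is a bigraded Lie algebra.
   Context: For $r\ge1$ define linear involutions on $\mathbb{Q}[y_0,\ldots,y_r]$ (on homogeneous $f$, extended linearly) by $$\sigma(f)(y_0,\ldots,y_r)=(-1)^{\deg f+r}f(y_r,\ldots,y_0),\qquad \tau(f)(y_0,y_1,\ldots,y_r)=(-1)^rf(y_0,y_r,\ldots,y_1).$$ $\mathfrak{p}_r\subset\mathbb{Q}[y_0,\ldots,y_r]$ is the graded vector space of polynomials $f$ with $f(y_0,\ldots,y_r)=f(-y_0,\ldots,-y_r)$ and $f+\sigma(f)=f+\tau(f)=0$. $D_{n+1}=\langle\sigma,\tau\rangle$ is the dihedral group of order $2(n+1)$ generated by $\sigma,\tau$, acting on the even-degree polynomials $h\in\mathbb{Q}[y_0,\ldots,y_n]$ by $\sigma(h)(y_0,\ldots,y_n)=(-1)^{n}h(y_n,\ldots,y_0)$ and $\tau(h)(y_0,y_1,\ldots,y_n)=(-1)^{n}h(y_0,y_n,\ldots,y_1)$, and $\varepsilon:D_{n+1}\to\{\pm1\}$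 is the orientation character, with $\varepsilon(\sigma)=\varepsilon(\tau)=-1$. The Ihara bracket of polynomials $f\in\mathbb{Q}[y_0,\ldots,y_r]$, $g\in\mathbb{Q}[y_0,\ldots,y_s]$ is $\{f,g\}=f\,\underline{\circ}\,g-g\,\underline{\circ}\,f\in\mathbb{Q}[y_0,\ldots,y_{r+s}]$, where for homogeneous $f$ (extended linearly) $$f\,\underline{\circ}\,g\,(y_0,\ldots,y_{r+s})=\sum_{i=0}^s f(y_i,\ldots,y_{i+r})\,g(y_0,\ldots,y_i,y_{i+r+1},\ldots,y_{r+s})+(-1)^{\deg f+r}\sum_{i=1}^s f(y_{i+r},\ldots,y_i)\,g(y_0,\ldots,y_{i-1},y_{i+r},\ldots,y_{r+s}).$$ The bigrading on $\mathfrak{p}$ is by polynomial degree and by $r$. *)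

theory Defs
  imports Complex_Main "HOL-Library.Poly_Mapping" "HOL-Library.Product_Plus"
    "HOL-Algebra.Bij" "HOL-Algebra.Generated_Groups"
    "HOL-Algebra.Sym_Groups"
begin

section \<open>Polynomials over the rationals in the variables y_0, y_1, ...\<close>

text \<open>A polynomial maps the exponent vectors of its monomials to their coefficients; the ring
  structure is the convolution product of the library. The ring in y_0, ..., y_r is the subset
  polys r.\<close>

type_synonym qpoly = "(nat \<Rightarrow>\<^sub>0 nat) \<Rightarrow>\<^sub>0 rat"

definition Y :: "nat \<Rightarrow> qpoly" where
  "Y i = Poly_Mapping.single (Poly_Mapping.single i 1) 1"

definition qscale :: "rat \<Rightarrow> qpoly \<Rightarrow> qpoly" where
  "qscale c f = Poly_Mapping.single 0 c * f"

definition polys :: "nat \<Rightarrow> qpoly set" where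
  "polys r = {f. \<forall>m\<in>Poly_Mapping.keys f. Poly_Mapping.keys m \<subseteq> {..r}}"

text \<open>poly_subst v f is f(v 0, v 1, ...).\<close>

definition poly_subst :: "(nat \<Rightarrow> qpoly) \<Rightarrow> qpoly \<Rightarrow> qpoly" where
  "poly_subst v f = (\<Sum>m\<in>Poly_Mapping.keys f. qscale (Poly_Mapping.lookup f m)
     (\<Prod>i\<in>Poly_Mapping.keys m. v i ^ Poly_Mapping.lookup m i))"

definition mono_degree :: "(nat \<Rightarrow>\<^sub>0 nat) \<Rightarrow> nat" where
  "mono_degree m = (\<Sum>i\<in>Poly_Mapping.keys m. Poly_Mapping.lookup m i)"

definition homogeneous :: "nat \<Rightarrow> qpoly \<Rightarrow> bool" where
  "homogeneous d f \<longleftrightarrow> (\<forall>m\<in>Poly_Mapping.keys f. mono_degree m = d)"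

definition hom_component :: "nat \<Rightarrow> qpoly \<Rightarrow> qpoly" where
  "hom_component d f = (\<Sum>m\<in>{m\<in>Poly_Mapping.keys f. mono_degree m = d}.
     Poly_Mapping.single m (Poly_Mapping.lookup f m))"

text \<open>Linear extension of a map given on homogeneous polynomials, where F d is the map on those
  of degree d.\<close>

definition hom_extend :: "(nat \<Rightarrow> qpoly \<Rightarrow> qpoly) \<Rightarrow> qpoly \<Rightarrow> qpoly" where
  "hom_extend F f = (\<Sum>d\<in>mono_degree ` Poly_Mapping.keys f. F d (hom_component d f))"


section \<open>The involutions and the spaces p_r\<close>

definition sigma :: "nat \<Rightarrow> qpoly \<Rightarrow> qpoly" where
  "sigma r = hom_extend (\<lambda>d f. (-1) ^ (d + r) * poly_subst (\<lambda>i. Y (r - i)) f)"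

definition tau :: "nat \<Rightarrow> qpoly \<Rightarrow> qpoly" where
  "tau r f = (-1) ^ r * poly_subst (\<lambda>i. if i = 0 then Y 0 else Y (r + 1 - i)) f"

definition pspace :: "nat \<Rightarrow> qpoly set" where
  "pspace r = {f \<in> polys r. f = poly_subst (\<lambda>i. - Y i) f \<and> f + sigma r f = 0 \<and> f + tau r f = 0}"


section \<open>The dihedral group and its orientation character\<close>

definition even_polys :: "nat \<Rightarrow> qpoly set" where
  "even_polys n = {h \<in> polys n. \<forall>m\<in>Poly_Mapping.keys h. even (mono_degree m)}"

definition dihedral_sigma :: "nat \<Rightarrow> qpoly \<Rightarrow> qpoly" where
  "dihedral_sigma n = (\<lambda>h\<in>even_polys n. (-1) ^ n * poly_subst (\<lambda>i. Y (n - i)) h)"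

definition dihedral_tau :: "nat \<Rightarrow> qpoly \<Rightarrow> qpoly" where
  "dihedral_tau n = (\<lambda>h\<in>even_polys n.
     (-1) ^ n * poly_subst (\<lambda>i. if i = 0 then Y 0 else Y (n + 1 - i)) h)"

text \<open>The group generated by the two involutions is realised as a group of bijections of the
  space of even-degree polynomials. For n at least 2 an element acting trivially on all the
  squares of the variables is trivial, so this is the dihedral group of order 2 (n + 1).\<close>

definition dihedral :: "nat \<Rightarrow> (qpoly \<Rightarrow> qpoly) monoid" where
  "dihedral n = subgroup_generated (BijGroup (even_polys n)) {dihedral_sigma n, dihedral_tau n}"

text \<open>The two values on generators determine the character uniquely on the carrier of the
  group; sign_img is the group with the two elements 1 and -1.\<close>

definition is_orientation_character :: "nat \<Rightarrow> ((qpoly \<Rightarrow> qpoly) \<Rightarrow> int) \<Rightarrow> bool" where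
  "is_orientation_character n e \<longleftrightarrow> e \<in> hom (dihedral n) sign_img \<and>
     e (dihedral_sigma n) = -1 \<and> e (dihedral_tau n) = -1"

definition orientation :: "nat \<Rightarrow> (qpoly \<Rightarrow> qpoly) \<Rightarrow> int" where
  "orientation n = (SOME e. is_orientation_character n e)"


section \<open>The Ihara bracket\<close>

definition ihara_circ :: "nat \<Rightarrow> nat \<Rightarrow> qpoly \<Rightarrow> qpoly \<Rightarrow> qpoly" where
  "ihara_circ r s f g = hom_extend (\<lambda>d f.
     (\<Sum>i=0..s. poly_subst (\<lambda>j. Y (i + j)) f
               * poly_subst (\<lambda>j. if j \<le> i then Y j else Y (j + r)) g)
     + (-1) ^ (d + r)
       * (\<Sum>i=1..s. poly_subst (\<lambda>j. Y (i + r - j)) f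
                  * poly_subst (\<lambda>j. if j < i then Y j else Y (j + r)) g)) f"

definition ihara_bracket :: "nat \<Rightarrow> nat \<Rightarrow> qpoly \<Rightarrow> qpoly \<Rightarrow> qpoly" where
  "ihara_bracket r s f g = ihara_circ r s f g - ihara_circ s r g f"


section \<open>Graded Lie algebras\<close>

locale lie_algebra = vector_space scale
  for scale :: "'k::field \<Rightarrow> 'v::ab_group_add \<Rightarrow> 'v" +
  fixes L :: "'v set" and bracket :: "'v \<Rightarrow> 'v \<Rightarrow> 'v"
  assumes subspace_carrier: "subspace L"
    and bracket_closed: "\<lbrakk>x \<in> L; y \<in> L\<rbrakk> \<Longrightarrow> bracket x y \<in> L"
    and bracket_add_left:
      "\<lbrakk>x \<in> L; y \<in> L; z \<in> L\<rbrakk> \<Longrightarrow> bracket (x + y) z = bracket x z + bracket y z"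
    and bracket_add_right:
      "\<lbrakk>x \<in> L; y \<in> L; z \<in> L\<rbrakk> \<Longrightarrow> bracket x (y + z) = bracket x y + bracket x z"
    and bracket_scale_left: "\<lbrakk>x \<in> L; y \<in> L\<rbrakk> \<Longrightarrow> bracket (scale c x) y = scale c (bracket x y)"
    and bracket_scale_right: "\<lbrakk>x \<in> L; y \<in> L\<rbrakk> \<Longrightarrow> bracket x (scale c y) = scale c (bracket x y)"
    and alternating: "x \<in> L \<Longrightarrow> bracket x x = 0"
    and jacobi: "\<lbrakk>x \<in> L; y \<in> L; z \<in> L\<rbrakk> \<Longrightarrow>
      bracket x (bracket y z) + bracket y (bracket z x) + bracket z (bracket x y) = 0"

locale graded_lie_algebra = lie_algebra scale L bracket
  for scale :: "'k::field \<Rightarrow> 'v::ab_group_add \<Rightarrow> 'v" and L bracket +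
  fixes component :: "'i::comm_monoid_add \<Rightarrow> 'v set"
  assumes component_subspace: "subspace (component i)"
    and component_subset: "component i \<subseteq> L"
    and component_decomposition: "x \<in> L \<Longrightarrow>
      \<exists>!c. finite {i. c i \<noteq> 0} \<and> (\<forall>i. c i \<in> component i) \<and> x = (\<Sum>i | c i \<noteq> 0. c i)"
    and bracket_component:
      "\<lbrakk>x \<in> component i; y \<in> component j\<rbrakk> \<Longrightarrow> bracket x y \<in> component (i + j)"


section \<open>The bigraded space p\<close>

text \<open>The external direct sum of the p_r over r at least 1, as finitely supported families.\<close>

definition pspace_sum :: "(nat \<Rightarrow>\<^sub>0 qpoly) set" where
  "pspace_sum = {F. Poly_Mapping.lookup F 0 = 0 \<and> (\<forall>r\<ge>1. Poly_Mapping.lookup F r \<in> pspace r)}"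

definition sum_scale :: "rat \<Rightarrow> (nat \<Rightarrow>\<^sub>0 qpoly) \<Rightarrow> (nat \<Rightarrow>\<^sub>0 qpoly)" where
  "sum_scale c = Poly_Mapping.map (qscale c)"

definition sum_bracket :: "(nat \<Rightarrow>\<^sub>0 qpoly) \<Rightarrow> (nat \<Rightarrow>\<^sub>0 qpoly) \<Rightarrow> (nat \<Rightarrow>\<^sub>0 qpoly)" where
  "sum_bracket F G = (\<Sum>r\<in>Poly_Mapping.keys F. \<Sum>s\<in>Poly_Mapping.keys G.
     Poly_Mapping.single (r + s)
       (ihara_bracket r s (Poly_Mapping.lookup F r) (Poly_Mapping.lookup G s)))"

text \<open>The bidegree is the pair of the polynomial degree and r.\<close>

definition pspace_component :: "nat \<times> nat \<Rightarrow> (nat \<Rightarrow>\<^sub>0 qpoly) set" where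
  "pspace_component = (\<lambda>(d, r). {F \<in> pspace_sum. Poly_Mapping.keys F \<subseteq> {r}
     \<and> homogeneous d (Poly_Mapping.lookup F r)})"

end

theory Submission
  imports Defs
begin

text \<open>
  The elements of \<open>p_r\<close> are even polynomials, they do not change under cyclic rotations of
  \<open>y_0, ..., y_r\<close>, and every reflection multiplies them by \<open>(-1) ^ (r + 1)\<close>: the maps \<open>sigma\<close> and \<open>tau\<close>
  are reflections, and their composition is the rotation by one step (\<open>pspace_reverse\<close>,
  \<open>pspace_rotate\<close>).

  Put the \<open>r + s + 1\<close> variables of the bracket on a circle, and write \<open>F_k\<close> and \<open>G_k\<close> for \<open>f\<close> and \<open>g\<close> at the
  consecutive points of the circle that start at position \<open>k\<close>. Each term of the Ihara operation is the
  product of \<open>f\<close> on an arc and of \<open>g\<close> on the complementary arc prolonged by one of the two end points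
  of the first arc, hence it is \<open>P_k = F_k * G_(k+r)\<close> or \<open>Q_k = F_k * G_(k+r+1)\<close>. The two halves of the
  bracket cover complementary ranges of \<open>k\<close>, so that \<open>{f, g}\<close> is the sum of all \<open>Q_k - P_k\<close> around the circle
  (\<open>ihara_bracket_cyclic\<close>). Rotations carry \<open>P_0\<close> to the \<open>P_k\<close>, and reflections carry it to the \<open>Q_k\<close>; this is
  the formula with the dihedral group (\<open>bracket_dihedral_sum\<close>), where \<open>r + s \<ge> 2\<close> guarantees that the
  rotations and reflections are \<open>2 * (r + s + 1)\<close> different maps. As reflections exchange the \<open>P_k\<close> with the
  \<open>Q_k\<close>, the bracket changes under them by the sign required in \<open>p_(r+s)\<close> (\<open>bracket_pspace\<close>).

  The Jacobi identity has a different source. Consider \<open>f\<close> as a function of words of length \<open>r + 1\<close>, read as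
  paths through their letters. Functions of words have a convolution product \<open>f * h\<close> along the
  composition of paths that share an end point, and the Ihara operation becomes \<open>D_f h + f * h\<close>, where \<open>D_f\<close>
  contracts a factor \<open>b\<close> of the word, weighted by \<open>f b\<close>, to its first letter minus its last letter. The
  operator \<open>D_f\<close> is a derivation of the product. On the indicator function \<open>e_x\<close> of the one-letter word
  \<open>[x]\<close> it takes the value \<open>e_x * f - f * e_x\<close>, and it kills the indicator function of the words of length
  2. Since these functions generate all others, \<open>D_f\<close> is determined by these values, and one finds that the
  commutator of \<open>D_f\<close> and \<open>D_g\<close> is \<open>D\<close> of the bracket \<open>{f, g} = D_f g - D_g f + f * g - g * f\<close>. In the formal proof
  the generators are replaced by an induction on the word (\<open>path_deriv_commutator\<close>). Consequently
  the Ihara operation satisfies \<open>{f, g} o h = f o (g o h) - g o (f o h)\<close> (\<open>path_circ_path_lie\<close>), which implies the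
  Jacobi identity for the functions of words, and evaluation at words is injective on the direct sum of
  the \<open>p_r\<close> (\<open>sum_path_fun_inject\<close>).
\<close>

section \<open>Substitution as a ring homomorphism\<close>

text \<open>The value of a monomial, so that substitution is the linear extension of \<open>mono_eval\<close>, and
  its multiplicativity (\<open>poly_subst_mult\<close>) comes from \<open>mono_eval_add\<close>.\<close>

definition mono_eval :: "(nat \<Rightarrow> qpoly) \<Rightarrow> (nat \<Rightarrow>\<^sub>0 nat) \<Rightarrow> qpoly" where
  "mono_eval v m = (\<Prod>i\<in>Poly_Mapping.keys m. v i ^ Poly_Mapping.lookup m i)"

lemma qscale_add: "qscale c (f + g) = qscale c f + qscale c g"
  by (simp add: qscale_def algebra_simps)

lemma qscale_add_left: "qscale (c + d) f = qscale c f + qscale d f"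
  by (simp add: qscale_def algebra_simps single_add)

lemma qscale_zero [simp]: "qscale 0 f = 0" "qscale c 0 = 0"
  by (simp_all add: qscale_def)

lemma qscale_one [simp]: "qscale 1 f = f"
  by (simp add: qscale_def)

lemma qscale_qscale: "qscale c (qscale d f) = qscale (c * d) f"
  by (simp add: qscale_def mult_single flip: mult.assoc)

lemma qscale_mult: "qscale c f * qscale d g = qscale (c * d) (f * g)"
proof -
  have "qscale c f * qscale d g = (Poly_Mapping.single 0 c * Poly_Mapping.single 0 d) * (f * g)"
    unfolding qscale_def by (simp only: ac_simps)
  then show ?thesis by (simp add: qscale_def mult_single)
qed

lemma qscale_single: "qscale c (Poly_Mapping.single m d) = Poly_Mapping.single m (c * d)"
  by (simp add: qscale_def mult_single)

lemma lookup_qscale: "Poly_Mapping.lookup (qscale c f) m = c * Poly_Mapping.lookup f m"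
  unfolding qscale_def mult_map_scale_conv_mult[symmetric]
  by (simp add: Poly_Mapping.map.rep_eq when_def)

lemma poly_mapping_as_sum:
  fixes f :: "'a \<Rightarrow>\<^sub>0 'b::comm_monoid_add"
  assumes "finite A" "Poly_Mapping.keys f \<subseteq> A"
  shows "(\<Sum>m\<in>A. Poly_Mapping.single m (Poly_Mapping.lookup f m)) = f"
  by (rule poly_mapping_eqI)
    (use assms in \<open>auto simp: lookup_sum lookup_single when_def in_keys_iff\<close>)

lemma poly_subst_superset:
  assumes "finite A" "Poly_Mapping.keys f \<subseteq> A"
  shows "poly_subst v f = (\<Sum>m\<in>A. qscale (Poly_Mapping.lookup f m) (mono_eval v m))"
  unfolding poly_subst_def mono_eval_def using assms
  by (intro sum.mono_neutral_left) (auto simp: in_keys_iff)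

lemma mono_eval_superset:
  assumes "finite A" "Poly_Mapping.keys m \<subseteq> A"
  shows "mono_eval v m = (\<Prod>i\<in>A. v i ^ Poly_Mapping.lookup m i)"
  unfolding mono_eval_def using assms
  by (intro prod.mono_neutral_left) (auto simp: in_keys_iff)

lemma mono_eval_add: "mono_eval v (m + m') = mono_eval v m * mono_eval v m'"
proof -
  let ?A = "Poly_Mapping.keys m \<union> Poly_Mapping.keys m'"
  have "Poly_Mapping.keys (m + m') \<subseteq> ?A" by (rule keys_add)
  then show ?thesis
    by (simp add: mono_eval_superset[of ?A] lookup_add power_add prod.distrib)
qed

lemma mono_eval_zero [simp]: "mono_eval v 0 = 1"
  by (simp add: mono_eval_def)

lemma poly_subst_single: "poly_subst v (Poly_Mapping.single m c) = qscale c (mono_eval v m)"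
  by (subst poly_subst_superset[of "{m}"]) auto

lemma poly_subst_zero [simp]: "poly_subst v 0 = 0"
  by (simp add: poly_subst_def)

lemma poly_subst_one [simp]: "poly_subst v 1 = 1"
  using poly_subst_single[of v 0 1] by simp

lemma poly_subst_add: "poly_subst v (f + g) = poly_subst v f + poly_subst v g"
proof -
  let ?A = "Poly_Mapping.keys f \<union> Poly_Mapping.keys g"
  have "Poly_Mapping.keys (f + g) \<subseteq> ?A" by (rule keys_add)
  then show ?thesis
    by (simp add: poly_subst_superset[of ?A] lookup_add qscale_add_left sum.distrib)
qed

lemma poly_subst_uminus: "poly_subst v (- f) = - poly_subst v f"
  using poly_subst_add[of v f "- f"] by (simp add: add_eq_0_iff)

lemma poly_subst_diff: "poly_subst v (f - g) = poly_subst v f - poly_subst v g"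
  using poly_subst_add[of v f "- g"] by (simp add: poly_subst_uminus)

lemma poly_subst_sum: "poly_subst v (sum f A) = (\<Sum>i\<in>A. poly_subst v (f i))"
  by (induction A rule: infinite_finite_induct) (simp_all add: poly_subst_add)

lemma poly_subst_mult: "poly_subst v (f * g) = poly_subst v f * poly_subst v g"
proof -
  let ?F = "\<lambda>f m. Poly_Mapping.single m (Poly_Mapping.lookup f m)"
  have "f * g = (\<Sum>m\<in>Poly_Mapping.keys f. \<Sum>m'\<in>Poly_Mapping.keys g. ?F f m * ?F g m')"
    by (subst sum_product[symmetric]) (simp add: poly_mapping_as_sum)
  then have "poly_subst v (f * g) = (\<Sum>m\<in>Poly_Mapping.keys f. \<Sum>m'\<in>Poly_Mapping.keys g.
      poly_subst v (?F f m) * poly_subst v (?F g m'))"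
    by (simp add: poly_subst_sum mult_single poly_subst_single mono_eval_add qscale_mult)
  also have "\<dots> = poly_subst v f * poly_subst v g"
    by (subst sum_product[symmetric]) (simp add: poly_mapping_as_sum flip: poly_subst_sum)
  finally show ?thesis .
qed

lemma poly_subst_power: "poly_subst v (f ^ k) = poly_subst v f ^ k"
  by (induction k) (simp_all add: poly_subst_mult)

lemma poly_subst_neg_one_power: "poly_subst v ((-1) ^ k) = (-1) ^ k"
  by (simp add: poly_subst_power poly_subst_uminus)

lemma poly_subst_prod: "poly_subst v (prod f A) = (\<Prod>i\<in>A. poly_subst v (f i))"
  by (induction A rule: infinite_finite_induct) (simp_all add: poly_subst_mult)

lemma poly_subst_qscale: "poly_subst v (qscale c f) = qscale c (poly_subst v f)"
  by (simp add: qscale_def poly_subst_mult poly_subst_single)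

lemma poly_subst_Y [simp]: "poly_subst v (Y i) = v i"
  by (simp add: Y_def poly_subst_single mono_eval_def)

lemma poly_subst_poly_subst: "poly_subst v (poly_subst u f) = poly_subst (\<lambda>i. poly_subst v (u i)) f"
  unfolding poly_subst_def[of u] poly_subst_def[of "\<lambda>i. poly_subst v (u i)"]
  by (simp add: poly_subst_sum poly_subst_qscale poly_subst_prod poly_subst_power)

lemma poly_subst_cong:
  assumes "f \<in> polys r" "\<And>i. i \<le> r \<Longrightarrow> u i = v i"
  shows "poly_subst u f = poly_subst v f"
  unfolding poly_subst_def
  by (intro sum.cong prod.cong refl arg_cong2[of _ _ _ _ qscale]) (use assms in \<open>force simp: polys_def\<close>)

lemma single_mono: "Poly_Mapping.single m (1::rat) = mono_eval Y m"
proof -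
  have pw: "Y i ^ k = Poly_Mapping.single (Poly_Mapping.single i k) 1" for i k
    by (induction k) (simp_all add: Y_def mult_single single_add[symmetric])
  have "finite A \<Longrightarrow> (\<Prod>i\<in>A. Y i ^ k i) = Poly_Mapping.single (\<Sum>i\<in>A. Poly_Mapping.single i (k i)) 1" for A k
    by (induction A rule: finite_induct) (simp_all add: pw mult_single)
  moreover have "(\<Sum>i\<in>Poly_Mapping.keys m. Poly_Mapping.single i (Poly_Mapping.lookup m i)) = m"
    by (rule poly_mapping_eqI) (auto simp: lookup_sum lookup_single when_def sum.delta in_keys_iff)
  ultimately show ?thesis by (simp add: mono_eval_def)
qed

lemma poly_subst_id [simp]: "poly_subst Y f = f"
proof -
  have "poly_subst Y f = (\<Sum>m\<in>Poly_Mapping.keys f. qscale (Poly_Mapping.lookup f m) (Poly_Mapping.single m 1))"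
    by (subst poly_subst_superset[of "Poly_Mapping.keys f"]) (simp_all add: single_mono)
  then show ?thesis by (simp add: qscale_single poly_mapping_as_sum)
qed

lemma polys_add: "f \<in> polys n \<Longrightarrow> g \<in> polys n \<Longrightarrow> f + g \<in> polys n"
  using keys_add[of f g] unfolding polys_def by blast

lemma polys_zero [simp]: "0 \<in> polys n"
  by (simp add: polys_def)

lemma polys_uminus: "f \<in> polys n \<Longrightarrow> - f \<in> polys n"
  by (simp add: polys_def)

lemma polys_diff: "f \<in> polys n \<Longrightarrow> g \<in> polys n \<Longrightarrow> f - g \<in> polys n"
  using polys_add[of f n "- g"] polys_uminus[of g n] by simp

lemma polys_mult:
  assumes "f \<in> polys n" "g \<in> polys n" shows "f * g \<in> polys n"
  unfolding polys_def
proof safe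
  fix m i assume "m \<in> Poly_Mapping.keys (f * g)" and i: "i \<in> Poly_Mapping.keys m"
  then obtain a b where ab: "a \<in> Poly_Mapping.keys f" "b \<in> Poly_Mapping.keys g" "m = a + b"
    using keys_mult[of f g] by blast
  then have "i \<in> Poly_Mapping.keys a \<union> Poly_Mapping.keys b" using i keys_add[of a b] by blast
  then show "i \<le> n" using ab assms unfolding polys_def by blast
qed

lemma polys_single_zero: "Poly_Mapping.single 0 c \<in> polys n"
  by (simp add: polys_def)

lemma polys_one [simp]: "1 \<in> polys n"
  using polys_single_zero[of 1 n] by simp

lemma polys_qscale: "f \<in> polys n \<Longrightarrow> qscale c f \<in> polys n"
  unfolding qscale_def by (intro polys_mult polys_single_zero)

lemma polys_sum: "(\<And>i. i \<in> A \<Longrightarrow> f i \<in> polys n) \<Longrightarrow> sum f A \<in> polys n"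
  by (induction A rule: infinite_finite_induct) (simp_all add: polys_add)

lemma polys_power: "f \<in> polys n \<Longrightarrow> f ^ k \<in> polys n"
  by (induction k) (simp_all add: polys_mult)

lemma polys_prod: "(\<And>i. i \<in> A \<Longrightarrow> f i \<in> polys n) \<Longrightarrow> prod f A \<in> polys n"
  by (induction A rule: infinite_finite_induct) (simp_all add: polys_mult)

lemma polys_Y: "i \<le> n \<Longrightarrow> Y i \<in> polys n"
  by (simp add: polys_def Y_def)

lemma polys_subst:
  assumes "f \<in> polys r" "\<And>i. i \<le> r \<Longrightarrow> v i \<in> polys n"
  shows "poly_subst v f \<in> polys n"
  unfolding poly_subst_def using assms
  by (intro polys_sum polys_qscale polys_prod polys_power assms) (force simp: polys_def)

lemma polys_neg_one_power: "(-1) ^ k \<in> polys n"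
  by (intro polys_power polys_uminus) simp

section \<open>Degrees and homogeneous components\<close>

lemma mono_degree_superset:
  assumes "finite A" "Poly_Mapping.keys m \<subseteq> A"
  shows "mono_degree m = (\<Sum>i\<in>A. Poly_Mapping.lookup m i)"
  unfolding mono_degree_def using assms
  by (intro sum.mono_neutral_left) (auto simp: in_keys_iff)

lemma mono_degree_add: "mono_degree (m + m') = mono_degree m + mono_degree m'"
proof -
  let ?A = "Poly_Mapping.keys m \<union> Poly_Mapping.keys m'"
  have "Poly_Mapping.keys (m + m') \<subseteq> ?A" by (rule keys_add)
  then show ?thesis
    by (simp add: mono_degree_superset[of ?A] lookup_add sum.distrib)
qed

lemma mono_degree_zero [simp]: "mono_degree 0 = 0"
  by (simp add: mono_degree_def)

lemma lookup_hom_component: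
  "Poly_Mapping.lookup (hom_component d f) m = (if mono_degree m = d then Poly_Mapping.lookup f m else 0)"
  unfolding hom_component_def
  by (auto simp: lookup_sum lookup_single when_def sum.delta in_keys_iff)

lemma hom_component_add: "hom_component d (f + g) = hom_component d f + hom_component d g"
  by (rule poly_mapping_eqI) (simp add: lookup_hom_component lookup_add)

lemma hom_component_zero [simp]: "hom_component d 0 = 0"
  by (rule poly_mapping_eqI) (simp add: lookup_hom_component)

lemma hom_component_uminus: "hom_component d (- f) = - hom_component d f"
  by (rule poly_mapping_eqI) (simp add: lookup_hom_component)

lemma hom_component_sum: "hom_component d (sum f A) = (\<Sum>i\<in>A. hom_component d (f i))"
  by (induction A rule: infinite_finite_induct) (simp_all add: hom_component_add)

lemma homogeneous_hom_component: "homogeneous d (hom_component d f)"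
  by (auto simp: homogeneous_def in_keys_iff lookup_hom_component split: if_splits)

lemma hom_component_homogeneous:
  "homogeneous e f \<Longrightarrow> hom_component d f = (if d = e then f else 0)"
  by (rule poly_mapping_eqI) (auto simp: lookup_hom_component homogeneous_def in_keys_iff)

lemma sum_hom_component:
  assumes "finite D" "mono_degree ` Poly_Mapping.keys f \<subseteq> D"
  shows "(\<Sum>d\<in>D. hom_component d f) = f"
proof (rule poly_mapping_eqI)
  fix m
  have "mono_degree m \<in> D \<or> Poly_Mapping.lookup f m = 0"
    using assms(2) by (auto simp: in_keys_iff)
  then show "Poly_Mapping.lookup (\<Sum>d\<in>D. hom_component d f) m = Poly_Mapping.lookup f m"
    using assms(1) by (auto simp: lookup_sum lookup_hom_component sum.delta')
qed

text \<open>A map given degree by degree agrees with an additive map as soon as it does so in the degrees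
  that occur. For an even polynomial only even degrees occur, so the sign \<open>(-1) ^ d\<close> in the
  definitions of \<open>sigma\<close> and of the insertion operation disappears.\<close>

lemma hom_extend_eq:
  assumes F: "\<And>d. d \<in> mono_degree ` Poly_Mapping.keys f \<Longrightarrow> F d (hom_component d f) = G (hom_component d f)"
    and add: "\<And>p q. G (p + q) = G p + G q" 
  shows "hom_extend F f = G f"
proof -
  have "G 0 = 0" using add[of 0 0] by simp
  then have s: "G (sum h A) = (\<Sum>i\<in>A. G (h i))" for h and A :: "nat set"
    by (induction A rule: infinite_finite_induct) (simp_all add: add)
  have "hom_extend F f = (\<Sum>d\<in>mono_degree ` Poly_Mapping.keys f. G (hom_component d f))"
    unfolding hom_extend_def by (intro sum.cong refl F)
  also have "\<dots> = G f" by (simp flip: s add: sum_hom_component)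
  finally show ?thesis .
qed

lemma homogeneous_add: "homogeneous d f \<Longrightarrow> homogeneous d g \<Longrightarrow> homogeneous d (f + g)"
  using keys_add[of f g] unfolding homogeneous_def by blast
lemma homogeneous_zero [simp]: "homogeneous d 0" by (simp add: homogeneous_def)

lemma homogeneous_uminus: "homogeneous d f \<Longrightarrow> homogeneous d (- f)" by (simp add: homogeneous_def)

lemma homogeneous_diff: "homogeneous d f \<Longrightarrow> homogeneous d g \<Longrightarrow> homogeneous d (f - g)"
  using homogeneous_add[of d f "- g"] homogeneous_uminus[of d g] by simp
lemma homogeneous_mult:
  assumes "homogeneous d f" "homogeneous e g" shows "homogeneous (d + e) (f * g)"
  using keys_mult[of f g] assms unfolding homogeneous_def by (fastforce simp: mono_degree_add)

lemma homogeneous_sum: "(\<And>i. i \<in> A \<Longrightarrow> homogeneous d (f i)) \<Longrightarrow> homogeneous d (sum f A)"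
  by (induction A rule: infinite_finite_induct) (simp_all add: homogeneous_add)

lemma homogeneous_qscale: "homogeneous d f \<Longrightarrow> homogeneous d (qscale c f)"
  by (auto simp: homogeneous_def in_keys_iff lookup_qscale)

lemma homogeneous_one: "homogeneous 0 1"
  by (simp add: homogeneous_def)

lemma homogeneous_Y: "homogeneous 1 (Y i)"
  by (simp add: homogeneous_def Y_def mono_degree_def)

lemma homogeneous_power: "homogeneous d f \<Longrightarrow> homogeneous (k * d) (f ^ k)"
  by (induction k) (simp_all add: homogeneous_mult homogeneous_one)

lemma homogeneous_prod:
  "(\<And>i. i \<in> A \<Longrightarrow> homogeneous (d i) (f i)) \<Longrightarrow> homogeneous (sum d A) (prod f A)"
  by (induction A rule: infinite_finite_induct) (simp_all add: homogeneous_mult homogeneous_one)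

lemma homogeneous_mono_eval:
  assumes "\<And>i. homogeneous 1 (v i)"
  shows "homogeneous (mono_degree m) (mono_eval v m)"
  unfolding mono_eval_def mono_degree_def
  by (rule homogeneous_prod) (use homogeneous_power[OF assms] in fastforce)

lemma homogeneous_subst:
  assumes "\<And>i. homogeneous 1 (v i)" "homogeneous d f"
  shows "homogeneous d (poly_subst v f)"
  unfolding poly_subst_def mono_eval_def[symmetric]
  by (intro homogeneous_sum homogeneous_qscale)
    (use homogeneous_mono_eval[OF assms(1)] assms(2) in \<open>auto simp: homogeneous_def\<close>)

text \<open>Substituting linear forms for the variables preserves the degree, and the homogeneous
  components are determined by their degrees.\<close>

lemma hom_component_subst:
  assumes "\<And>i. homogeneous 1 (v i)"
  shows "hom_component d (poly_subst v f) = poly_subst v (hom_component d f)"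
proof -
  let ?D = "insert d (mono_degree ` Poly_Mapping.keys f)"
  have h: "homogeneous e (poly_subst v (hom_component e f))" for e
    by (rule homogeneous_subst[OF assms homogeneous_hom_component])
  have "hom_component d (poly_subst v f) = (\<Sum>e\<in>?D. hom_component d (poly_subst v (hom_component e f)))"
    by (subst sum_hom_component[of ?D f, symmetric])
      (simp_all only: poly_subst_sum hom_component_sum finite_imageI finite_insert finite_keys subset_insertI)
  also have "\<dots> = (\<Sum>e\<in>?D. if e = d then poly_subst v (hom_component d f) else 0)"
    by (intro sum.cong refl) (auto simp: hom_component_homogeneous[OF h])
  also have "\<dots> = poly_subst v (hom_component d f)"
    by (subst sum.delta) auto
  finally show ?thesis .
qed

section \<open>A Lie bracket on functions of words\<close>

text \<open>Functions of words are compared through their values at the empty word and their left quotients,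
  which turns the identities below into inductions on the word.\<close>

definition left_quot :: "'a \<Rightarrow> ('a list \<Rightarrow> 'b) \<Rightarrow> 'a list \<Rightarrow> 'b" where
  "left_quot x h = (\<lambda>w. h (x # w))"

definition concat_prod :: "('a list \<Rightarrow> 'b::comm_ring_1) \<Rightarrow> ('a list \<Rightarrow> 'b) \<Rightarrow> 'a list \<Rightarrow> 'b" where
  "concat_prod f h w = (\<Sum>i\<le>length w. f (take i w) * h (drop i w))"

text \<open>A word is read as a path through its letters. Two paths are multiplied when the last letter of
  the first one is the first letter of the second one, and this letter then occurs once in the
  product; \<open>path_prod\<close> is the resulting convolution, while \<open>concat_prod\<close> is the convolution for
  plain concatenation.\<close>

definition path_prod :: "('a list \<Rightarrow> 'b::comm_ring_1) \<Rightarrow> ('a list \<Rightarrow> 'b) \<Rightarrow> 'a list \<Rightarrow> 'b" where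
  "path_prod f h w = (\<Sum>i<length w. f (take (Suc i) w) * h (drop i w))"

text \<open>For \<open>f [] = 0\<close> this is the sum over all factorisations \<open>w = a @ b @ c\<close> of
  \<open>f b * (h (a @ hd b # c) - h (a @ last b # c))\<close>: the factor \<open>b\<close> is contracted to its first letter, and
  to its last letter with the opposite sign. The recursion separates the factorisations with \<open>a = []\<close>:
  those that contract to the first letter form a concatenation product, those that contract to the
  last letter form a path product. See \<open>path_deriv_window\<close> for the explicit sum.\<close>

fun path_deriv :: "('a list \<Rightarrow> 'b::comm_ring_1) \<Rightarrow> ('a list \<Rightarrow> 'b) \<Rightarrow> 'a list \<Rightarrow> 'b" where
  "path_deriv f h [] = 0"
| "path_deriv f h (x # w) = concat_prod f (left_quot x h) (x # w) - path_prod f h (x # w) + path_deriv f (left_quot x h) w"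

text \<open>The analogue of the Ihara insertion operation for functions of words; the correspondence is
  \<open>path_circ_path_fun\<close>.\<close>

definition path_circ :: "('a list \<Rightarrow> 'b::comm_ring_1) \<Rightarrow> ('a list \<Rightarrow> 'b) \<Rightarrow> 'a list \<Rightarrow> 'b" where
  "path_circ f h w = path_deriv f h w + path_prod f h w"

definition path_lie :: "('a list \<Rightarrow> 'b::comm_ring_1) \<Rightarrow> ('a list \<Rightarrow> 'b) \<Rightarrow> 'a list \<Rightarrow> 'b" where
  "path_lie f g w = path_circ f g w - path_circ g f w"

lemma left_quot_apply [simp]: "left_quot x h w = h (x # w)" by (simp add: left_quot_def)

lemma concat_prod_Nil [simp]: "concat_prod f h [] = f [] * h []" by (simp add: concat_prod_def)

lemma path_prod_Nil [simp]: "path_prod f h [] = 0" by (simp add: path_prod_def)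

lemma concat_prod_Cons: "concat_prod f h (x # w) = f [] * h (x # w) + concat_prod (left_quot x f) h w"
  by (simp add: concat_prod_def sum.atMost_Suc_shift del: sum.atMost_Suc)

lemma path_prod_Cons: "path_prod f h (x # w) = f [x] * h (x # w) + path_prod (left_quot x f) h w"
  by (simp add: path_prod_def sum.lessThan_Suc_shift del: sum.lessThan_Suc)

lemma left_quot_concat_prod: "left_quot x (concat_prod f h) = (\<lambda>w. f [] * left_quot x h w + concat_prod (left_quot x f) h w)"
  by (rule ext) (simp add: concat_prod_Cons)

lemma left_quot_path_prod: "left_quot x (path_prod f h) = (\<lambda>w. f [x] * left_quot x h w + path_prod (left_quot x f) h w)"
  by (rule ext) (simp add: path_prod_Cons)

lemma left_quot_path_deriv: "left_quot x (path_deriv f h) =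
    (\<lambda>w. left_quot x (concat_prod f (left_quot x h)) w - left_quot x (path_prod f h) w + path_deriv f (left_quot x h) w)"
  by (rule ext) simp

lemma left_quot_linear:
  "left_quot x (\<lambda>w. f w + g w) = (\<lambda>w. left_quot x f w + left_quot x g w)"
  "left_quot x (\<lambda>w. f w - g w) = (\<lambda>w. left_quot x f w - left_quot x g w)"
  "left_quot x (\<lambda>w. c * f w) = (\<lambda>w. c * left_quot x f w)"
  by (simp_all add: fun_eq_iff)

lemma concat_prod_linear:
  "concat_prod (\<lambda>w. f w + g w) h w = concat_prod f h w + concat_prod g h w"
  "concat_prod (\<lambda>w. f w - g w) h w = concat_prod f h w - concat_prod g h w"
  "concat_prod (\<lambda>w. c * f w) h w = c * concat_prod f h w"
  "concat_prod h (\<lambda>w. f w + g w) w = concat_prod h f w + concat_prod h g w"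
  "concat_prod h (\<lambda>w. f w - g w) w = concat_prod h f w - concat_prod h g w"
  "concat_prod h (\<lambda>w. c * f w) w = c * concat_prod h f w"
  by (simp_all add: concat_prod_def algebra_simps sum.distrib sum_subtractf sum_distrib_left)

lemma path_prod_linear:
  "path_prod (\<lambda>w. f w + g w) h w = path_prod f h w + path_prod g h w"
  "path_prod (\<lambda>w. f w - g w) h w = path_prod f h w - path_prod g h w"
  "path_prod (\<lambda>w. c * f w) h w = c * path_prod f h w"
  "path_prod h (\<lambda>w. f w + g w) w = path_prod h f w + path_prod h g w"
  "path_prod h (\<lambda>w. f w - g w) w = path_prod h f w - path_prod h g w"
  "path_prod h (\<lambda>w. c * f w) w = c * path_prod h f w"
  by (simp_all add: path_prod_def algebra_simps sum.distrib sum_subtractf sum_distrib_left)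

lemma path_deriv_linear:
  "path_deriv (\<lambda>w. f w + g w) h w = path_deriv f h w + path_deriv g h w"
  "path_deriv (\<lambda>w. f w - g w) h w = path_deriv f h w - path_deriv g h w"
  "path_deriv (\<lambda>w. c * f w) h w = c * path_deriv f h w"
  "path_deriv k (\<lambda>w. f w + g w) w = path_deriv k f w + path_deriv k g w"
  "path_deriv k (\<lambda>w. f w - g w) w = path_deriv k f w - path_deriv k g w"
  "path_deriv k (\<lambda>w. c * f w) w = c * path_deriv k f w"
  by (induction w arbitrary: f g h)
    (simp_all add: concat_prod_linear path_prod_linear left_quot_linear algebra_simps del: left_quot_apply)

lemma path_prod_assoc: "path_prod (path_prod f g) h w = path_prod f (path_prod g h) w"
  by (induction w arbitrary: f)
    (simp_all add: path_prod_Cons left_quot_path_prod path_prod_linear algebra_simps del: left_quot_apply)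

text \<open>The last term comes from the splittings in which \<open>g\<close> receives the empty word: they occur on the
  left, whereas \<open>path_prod f g\<close> only evaluates \<open>g\<close> at nonempty words. The last term of the next
  identity has the same origin.\<close>

lemma path_prod_concat_prod: "path_prod f (concat_prod g k) w = concat_prod (path_prod f g) k w + g [] * path_prod f k w"
  by (induction w arbitrary: f)
    (simp_all add: path_prod_Cons left_quot_path_prod concat_prod_Cons path_prod_linear concat_prod_linear algebra_simps del: left_quot_apply)

lemma concat_prod_path_prod: "path_prod (concat_prod f k) h w = concat_prod f (path_prod k h) w + k [] * path_prod f h w"
  by (induction w arbitrary: f)
    (simp_all add: path_prod_Cons left_quot_concat_prod concat_prod_Cons path_prod_linear concat_prod_linear algebra_simps del: left_quot_apply,
     simp add: algebra_simps)

lemma concat_prod_assoc: "concat_prod (concat_prod f g) h w = concat_prod f (concat_prod g h) w"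
  by (induction w arbitrary: f)
    (simp_all add: left_quot_concat_prod concat_prod_Cons concat_prod_linear algebra_simps del: left_quot_apply)

text \<open>After the contraction of \<open>b\<close> in \<open>a @ b @ c\<close> the word is split into two paths. If the common letter of
  the paths is not the one that replaces \<open>b\<close>, then \<open>b\<close> is contracted inside one of them. Otherwise
  \<open>g (a @ [hd b]) * h (hd b # c) - g (a @ [last b]) * h (last b # c)\<close> is the contraction of \<open>b\<close> at the
  end of the first path followed by \<open>h (last b # c)\<close>, plus \<open>g (a @ [hd b])\<close> followed by the contraction
  of \<open>b\<close> at the beginning of the second path.\<close>

lemma path_deriv_path_prod:
  assumes f0: "f [] = 0"
  shows "path_deriv f (path_prod g h) w = path_prod (path_deriv f g) h w + path_prod g (path_deriv f h) w"
proof (induction w arbitrary: g)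
  case Nil then show ?case by simp
next
  case (Cons x w)
  have 1: "path_prod (left_quot x (concat_prod f (left_quot x g))) h w = path_prod (concat_prod f (left_quot x g)) h (x # w) - f [x] * g [x] * h (x # w)"
    by (simp add: path_prod_Cons concat_prod_Cons f0)
  have 2: "path_prod (left_quot x (path_prod f g)) h w = path_prod (path_prod f g) h (x # w) - f [x] * g [x] * h (x # w)"
    by (simp add: path_prod_Cons)
  have 3: "path_deriv f g [x] = 0"
    by (simp add: concat_prod_Cons path_prod_Cons f0)
  have E1: "path_deriv f (path_prod g h) (x # w) =
     g [x] * concat_prod f (left_quot x h) (x # w) + concat_prod f (path_prod (left_quot x g) h) (x # w) - path_prod f (path_prod g h) (x # w)
      + g [x] * path_deriv f (left_quot x h) w + path_prod (path_deriv f (left_quot x g)) h w + path_prod (left_quot x g) (path_deriv f h) w"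
    by (simp add: left_quot_path_prod concat_prod_linear path_deriv_linear Cons.IH del: left_quot_apply)
  have E2: "path_prod (path_deriv f g) h (x # w) = path_prod (concat_prod f (left_quot x g)) h (x # w) - path_prod (path_prod f g) h (x # w)
     + path_prod (path_deriv f (left_quot x g)) h w"
    by (simp only: path_prod_Cons[of "path_deriv f g"] 3 left_quot_path_deriv path_prod_linear 1 2) simp
  have E3: "path_prod g (path_deriv f h) (x # w) = g [x] * (concat_prod f (left_quot x h) (x # w) - path_prod f h (x # w)
      + path_deriv f (left_quot x h) w) + path_prod (left_quot x g) (path_deriv f h) w"
    by (simp add: path_prod_Cons[of g])
  show ?case
    unfolding E1 E2 E3 concat_prod_path_prod path_prod_assoc by (simp add: algebra_simps)
qed

text \<open>The function that takes the value 1 at words of length 2 and vanishes elsewhere is killed by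
  \<open>path_deriv f\<close>, and for functions vanishing at the empty word the concatenation product is the path
  product with this function in the middle. This is why the same rule holds for concatenation.\<close>

lemma path_deriv_concat_prod:
  assumes f0: "f [] = 0"
  shows "path_deriv f (concat_prod g k) w = concat_prod (path_deriv f g) k w + concat_prod g (path_deriv f k) w"
proof (induction w arbitrary: g)
  case Nil then show ?case by simp
next
  case (Cons x w)
  have 1: "concat_prod (left_quot x (concat_prod f (left_quot x g))) k w = concat_prod (concat_prod f (left_quot x g)) k (x # w)"
    by (simp add: concat_prod_Cons f0)
  have 2: "concat_prod (left_quot x (path_prod f g)) k w = concat_prod (path_prod f g) k (x # w)"
    by (simp add: concat_prod_Cons)
  have E1: "path_deriv f (concat_prod g k) (x # w) =
     g [] * concat_prod f (left_quot x k) (x # w) + concat_prod f (concat_prod (left_quot x g) k) (x # w) - path_prod f (concat_prod g k) (x # w)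
      + g [] * path_deriv f (left_quot x k) w + concat_prod (path_deriv f (left_quot x g)) k w + concat_prod (left_quot x g) (path_deriv f k) w"
    by (simp add: left_quot_concat_prod concat_prod_linear path_deriv_linear Cons.IH del: left_quot_apply)
  have E2: "concat_prod (path_deriv f g) k (x # w) = concat_prod (concat_prod f (left_quot x g)) k (x # w) - concat_prod (path_prod f g) k (x # w)
     + concat_prod (path_deriv f (left_quot x g)) k w"
    by (simp only: concat_prod_Cons[of "path_deriv f g"] left_quot_path_deriv concat_prod_linear 1 2) simp
  have E3: "concat_prod g (path_deriv f k) (x # w) = g [] * (concat_prod f (left_quot x k) (x # w) - path_prod f k (x # w)
      + path_deriv f (left_quot x k) w) + concat_prod (left_quot x g) (path_deriv f k) w"
    by (simp add: concat_prod_Cons[of g])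
  show ?case
    unfolding E1 E2 E3 path_prod_concat_prod concat_prod_assoc by (simp add: algebra_simps)
qed

text \<open>Both derivation rules turn the recursion of the outer derivation into an expression in which, apart
  from the terms with \<open>path_circ f g\<close>, everything is symmetric in \<open>f\<close> and \<open>g\<close> or of the same shape one
  letter further on.\<close>

lemma path_deriv_path_deriv_Cons:
  assumes f0: "f [] = 0" and g0: "g [] = 0"
  shows "path_deriv f (path_deriv g h) (x # w) =
    concat_prod f (path_deriv g (left_quot x h)) (x # w) + concat_prod g (path_deriv f (left_quot x h)) (x # w)
    + concat_prod (path_circ f g) (left_quot x h) (x # w)
    - path_prod f (path_deriv g h) (x # w) - path_prod g (path_deriv f h) (x # w) - path_prod (path_circ f g) h (x # w)
    + path_deriv f (path_deriv g (left_quot x h)) w"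
proof -
  have tl: "path_deriv f (left_quot x k) w = path_deriv f k (x # w) - concat_prod f (left_quot x k) (x # w) + path_prod f k (x # w)" for k
    by simp
  show ?thesis
    unfolding path_deriv.simps(2)[of f "path_deriv g h"] left_quot_path_deriv concat_prod_linear path_deriv_linear tl
      path_deriv_concat_prod[of f, OF f0] path_deriv_path_prod[of f, OF f0] path_prod_concat_prod path_circ_def[abs_def] path_prod_linear path_prod_assoc g0
    by (simp add: algebra_simps del: left_quot_apply)
qed

text \<open>Exchanging \<open>f\<close> and \<open>g\<close> in the previous identity and subtracting leaves exactly the recursion of the
  derivation attached to the bracket.\<close>

lemma path_deriv_commutator:
  assumes f0: "f [] = 0" and g0: "g [] = 0"
  shows "path_deriv f (path_deriv g h) w - path_deriv g (path_deriv f h) w = path_deriv (path_lie f g) h w"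
proof (induction w arbitrary: h)
  case Nil then show ?case by simp
next
  case (Cons x w)
  show ?case
    unfolding path_deriv_path_deriv_Cons[of f g, OF f0 g0] path_deriv_path_deriv_Cons[of g f, OF g0 f0] path_deriv.simps(2)[of "path_lie f g"]
      Cons.IH[symmetric]
    unfolding path_lie_def[abs_def] concat_prod_linear path_prod_linear
    by (simp add: algebra_simps)
qed

lemma path_circ_linear:
  "path_circ (\<lambda>w. f w + g w) h w = path_circ f h w + path_circ g h w"
  "path_circ (\<lambda>w. f w - g w) h w = path_circ f h w - path_circ g h w"
  "path_circ (\<lambda>w. c * f w) h w = c * path_circ f h w"
  "path_circ k (\<lambda>w. f w + g w) w = path_circ k f w + path_circ k g w"
  "path_circ k (\<lambda>w. f w - g w) w = path_circ k f w - path_circ k g w"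
  "path_circ k (\<lambda>w. c * f w) w = c * path_circ k f w"
  by (simp_all add: path_circ_def path_prod_linear path_deriv_linear algebra_simps)

text \<open>The insertion operation is a left action of the Lie bracket, in other words it is a pre-Lie product.
  The Jacobi identity is a formal consequence of this.\<close>

lemma path_circ_path_lie:
  assumes f0: "f [] = 0" and g0: "g [] = 0"
  shows "path_circ (path_lie f g) h w = path_circ f (path_circ g h) w - path_circ g (path_circ f h) w"
proof -
  have "path_circ (path_lie f g) h w = path_deriv f (path_deriv g h) w - path_deriv g (path_deriv f h) w + path_prod (path_lie f g) h w"
    by (simp add: path_circ_def path_deriv_commutator[of f g, OF f0 g0])
  then show ?thesis
    by (simp add: path_circ_def[abs_def] path_lie_def[abs_def] path_deriv_linear path_prod_linear
        path_deriv_path_prod[of f, OF f0] path_deriv_path_prod[of g, OF g0] path_prod_assoc algebra_simps)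
qed

lemma path_lie_linear:
  "path_lie (\<lambda>w. f w + g w) h w = path_lie f h w + path_lie g h w"
  "path_lie (\<lambda>w. c * f w) h w = c * path_lie f h w"
  "path_lie h (\<lambda>w. f w + g w) w = path_lie h f w + path_lie h g w"
  "path_lie h (\<lambda>w. c * f w) w = c * path_lie h f w"
  by (simp_all add: path_lie_def path_circ_linear algebra_simps)

lemma path_lie_jacobi:
  fixes f g h :: "'a list \<Rightarrow> 'b::comm_ring_1"
  assumes "f [] = 0" "g [] = 0" "h [] = 0"
  shows "path_lie f (path_lie g h) w + path_lie g (path_lie h f) w + path_lie h (path_lie f g) w = 0"
proof -
  have "path_lie f (path_lie g h) w = path_circ f (path_circ g h) w - path_circ f (path_circ h g) w - path_circ g (path_circ h f) w + path_circ h (path_circ g f) w"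
    if "g [] = 0" "h [] = 0" for f g h :: "'a list \<Rightarrow> 'b"
    using that by (simp add: path_lie_def[of f] path_circ_path_lie) (simp add: path_lie_def[abs_def] path_circ_linear)
  with assms show ?thesis by simp
qed

section \<open>Rotations and reflections of elements of p_r\<close>

text \<open>The substitution of \<open>- Y i\<close> for \<open>Y i\<close> acts diagonally on monomials. This makes evenness
  an equation between substitutions, so that it passes to products and to substituted variables
  without any reference to monomials.\<close>

lemma poly_subst_neg:
  "Poly_Mapping.lookup (poly_subst (\<lambda>i. - Y i) f) m = (-1) ^ mono_degree m * Poly_Mapping.lookup f m"
proof -
  have "mono_eval (\<lambda>i. - Y i) m = qscale ((-1) ^ mono_degree m) (mono_eval Y m)" for m
  proof -
    have "mono_eval (\<lambda>i. - Y i) m = (\<Prod>i\<in>Poly_Mapping.keys m. qscale ((-1) ^ Poly_Mapping.lookup m i) (Y i ^ Poly_Mapping.lookup m i))"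
      unfolding mono_eval_def
      by (intro prod.cong refl, subst power_minus) (auto simp: qscale_def single_uminus minus_one_power_iff)
    also have "finite A \<Longrightarrow> (\<Prod>i\<in>A. qscale ((-1) ^ k i) (h i)) = qscale ((-1) ^ (\<Sum>i\<in>A. k i)) (\<Prod>i\<in>A. h i)"
      for A and k :: "nat \<Rightarrow> nat" and h
      by (induction A rule: finite_induct) (simp_all add: qscale_mult power_add)
    from this[of "Poly_Mapping.keys m"] have "(\<Prod>i\<in>Poly_Mapping.keys m. qscale ((-1) ^ Poly_Mapping.lookup m i) (Y i ^ Poly_Mapping.lookup m i))
       = qscale ((-1) ^ mono_degree m) (mono_eval Y m)"
      by (simp add: mono_degree_def mono_eval_def)
    finally show ?thesis .
  qed
  then have "poly_subst (\<lambda>i. - Y i) f = (\<Sum>m\<in>Poly_Mapping.keys f. Poly_Mapping.single m ((-1) ^ mono_degree m * Poly_Mapping.lookup f m))"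
    by (simp add: poly_subst_superset[of "Poly_Mapping.keys f"] qscale_qscale qscale_single ac_simps flip: single_mono)
  then show ?thesis
    by (auto simp: lookup_sum lookup_single when_def in_keys_iff)
qed

lemma even_polys_iff: "h \<in> even_polys n \<longleftrightarrow> h \<in> polys n \<and> poly_subst (\<lambda>i. - Y i) h = h"
proof -
  have "poly_subst (\<lambda>i. - Y i) h = h \<longleftrightarrow> (\<forall>m\<in>Poly_Mapping.keys h. even (mono_degree m))"
    by (auto simp: poly_mapping_eq_iff fun_eq_iff poly_subst_neg minus_one_power_iff in_keys_iff)
  then show ?thesis by (auto simp: even_polys_def)
qed

lemma sigma_even:
  assumes "f \<in> even_polys r"
  shows "sigma r f = (-1) ^ r * poly_subst (\<lambda>i. Y (r - i)) f"
  unfolding sigma_def using assms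
  by (intro hom_extend_eq) (auto simp: poly_subst_add algebra_simps even_polys_def power_add)

lemma pspace_iff:
  "f \<in> pspace r \<longleftrightarrow> f \<in> even_polys r \<and> (-1) ^ r * poly_subst (\<lambda>i. Y (r - i)) f = - f
     \<and> (-1) ^ r * poly_subst (\<lambda>i. if i = 0 then Y 0 else Y (r + 1 - i)) f = - f"
proof -
  have "f \<in> pspace r \<longleftrightarrow> f \<in> even_polys r \<and> f + sigma r f = 0 \<and> f + tau r f = 0"
    by (auto simp: pspace_def even_polys_iff)
  then show ?thesis by (auto simp: sigma_even tau_def add_eq_0_iff)
qed

lemma pspace_polys: "f \<in> pspace r \<Longrightarrow> f \<in> polys r"
  by (simp add: pspace_def)

lemma pspace_even: "f \<in> pspace r \<Longrightarrow> f \<in> even_polys r"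
  by (simp add: pspace_iff)

lemma neg_one_power_cancel: "(-1) ^ r * a = b \<longleftrightarrow> a = (-1) ^ r * (b::qpoly)"
  by (cases "even r") auto

text \<open>The symmetry under reversal persists for arbitrary arguments \<open>v\<close>, because substituting them is a
  ring homomorphism.\<close>

lemma pspace_reverse:
  assumes "f \<in> pspace r"
  shows "poly_subst (\<lambda>j. v (r - j)) f = - ((-1) ^ r * poly_subst v f)"
proof -
  have "poly_subst v (poly_subst (\<lambda>i. Y (r - i)) f) = poly_subst v ((-1) ^ r * (- f))"
    using assms by (simp add: pspace_iff neg_one_power_cancel)
  then show ?thesis
    by (simp add: poly_subst_poly_subst poly_subst_mult poly_subst_neg_one_power poly_subst_uminus)
qed

lemma pspace_tau:
  assumes "f \<in> pspace r"
  shows "poly_subst (\<lambda>j. v (if j = 0 then 0 else r + 1 - j)) f = - ((-1) ^ r * poly_subst v f)"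
proof -
  have "poly_subst v (poly_subst (\<lambda>i. if i = 0 then Y 0 else Y (r + 1 - i)) f) = poly_subst v ((-1) ^ r * (- f))"
    using assms by (simp add: pspace_iff neg_one_power_cancel)
  then show ?thesis
    by (simp add: poly_subst_poly_subst poly_subst_mult poly_subst_neg_one_power poly_subst_uminus if_distrib
        cong: if_cong)
qed

text \<open>The composition of the two reflections \<open>sigma\<close> and \<open>tau\<close> is the rotation by one step, and the
  signs of the two reflections cancel.\<close>

lemma pspace_rotate:
  assumes "f \<in> pspace r"
  shows "poly_subst (\<lambda>j. v ((j + k) mod Suc r)) f = poly_subst v f"
proof (induction k arbitrary: v)
  case 0
  show ?case by (rule poly_subst_cong[OF pspace_polys[OF assms]]) simp
next
  case (Suc k)
  \<comment> \<open>\<open>?u\<close> at \<open>r - j\<close> is \<open>v\<close> at \<open>j + 1\<close>, taken modulo \<open>r + 1\<close>.\<close>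
  let ?u = "\<lambda>j. v (if j = 0 then 0 else r + 1 - j)"
  have "poly_subst (\<lambda>j. v ((j + Suc k) mod Suc r)) f = poly_subst (\<lambda>j. v (Suc ((j + k) mod Suc r) mod Suc r)) f"
    by (simp add: mod_Suc_eq)
  also have "\<dots> = poly_subst (\<lambda>j. v (Suc j mod Suc r)) f"
    by (rule Suc.IH)
  also have "\<dots> = poly_subst (\<lambda>j. ?u (r - j)) f"
    by (rule poly_subst_cong[OF pspace_polys[OF assms]]) (auto simp: mod_Suc le_eq_less_or_eq)
  also have "\<dots> = poly_subst v f"
    unfolding pspace_reverse[OF assms, of ?u] pspace_tau[OF assms] by (simp flip: mult.assoc power_add mult_2)
  finally show ?case .
qed

section \<open>The bracket as a sum around the circle\<close>

text \<open>The variables \<open>y_0, ..., y_n\<close> placed on a circle, so that indices are integers modulo \<open>n + 1\<close>;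
  \<open>window n f k\<close> is then \<open>f\<close> evaluated at consecutive points of the circle, starting at position
  \<open>k\<close>.\<close>

definition Yc :: "nat \<Rightarrow> int \<Rightarrow> qpoly" where
  "Yc n i = Y (nat (i mod int (Suc n)))"

definition window :: "nat \<Rightarrow> qpoly \<Rightarrow> int \<Rightarrow> qpoly" where
  "window n f k = poly_subst (\<lambda>j. Yc n (k + int j)) f"

lemma Yc_cong: "i mod int (Suc n) = j mod int (Suc n) \<Longrightarrow> Yc n i = Yc n j"
  by (simp add: Yc_def)

lemma Yc_nat: "i \<le> n \<Longrightarrow> Yc n (int i) = Y i"
  by (simp add: Yc_def)

lemma window_cong: "k mod int (Suc n) = l mod int (Suc n) \<Longrightarrow> window n f k = window n f l"
  unfolding window_def by (intro arg_cong2[of _ _ _ _ poly_subst] refl ext Yc_cong) (metis mod_add_left_eq)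

lemma window_mod: "window n f ((k mod int (Suc n)) + c) = window n f (k + c)"
  by (rule window_cong) (simp add: mod_add_left_eq)

lemma sum_periodic:
  fixes h :: "int \<Rightarrow> 'b::comm_monoid_add"
  assumes h: "\<And>k. h (k mod int (Suc n)) = h k"
  shows "(\<Sum>k\<le>n. h (int k + c)) = (\<Sum>k\<le>n. h (int k))" (is ?shift)
    and "(\<Sum>k\<le>n. h (c - int k)) = (\<Sum>k\<le>n. h (int k))" (is ?reflect)
proof -
  define m where "m z = nat (z mod int (Suc n))" for z
  have lt: "m z \<le> n" for z
    using pos_mod_bound[of "int (Suc n)" z] unfolding m_def by linarith
  have int_m: "int (m z) = z mod int (Suc n)" for z
    by (simp add: m_def)
  have m_int: "m (int k) = k" if "k \<le> n" for k
    using that by (simp add: m_def)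
  have hm: "h (int (m z)) = h z" for z
    unfolding int_m by (rule h)
  have mm: "m (int (m z) + d) = m (z + d)" "m (d - int (m z)) = m (d - z)" for z d
    unfolding int_m by (simp_all only: m_def mod_add_left_eq mod_diff_right_eq)
  show ?shift
  proof (rule sum.reindex_bij_witness[where i = "\<lambda>k. m (int k - c)" and j = "\<lambda>k. m (int k + c)"])
    fix k assume k: "k \<in> {..n}"
    have "m (int (m (int k - c)) + c) = m (int k)"
      unfolding mm(1) by (rule arg_cong[of _ _ m]) simp
    then show "m (int (m (int k - c)) + c) = k" using k m_int by simp
    have "m (int (m (int k + c)) + (- c)) = m (int k)"
      unfolding mm(1) by (rule arg_cong[of _ _ m]) simp
    then show "m (int (m (int k + c)) - c) = k" using k m_int by simp
    show "h (int (m (int k + c))) = h (int k + c)" by (rule hm)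
  qed (simp_all only: lt atMost_iff)
  show ?reflect
  proof (rule sum.reindex_bij_witness[where i = "\<lambda>k. m (c - int k)" and j = "\<lambda>k. m (c - int k)"])
    fix k assume k: "k \<in> {..n}"
    have "m (c - int (m (c - int k))) = m (int k)"
      unfolding mm(2) by (rule arg_cong[of _ _ m]) simp
    then show "m (c - int (m (c - int k))) = k" using k m_int by simp
    then show "m (c - int (m (c - int k))) = k" .
    show "h (int (m (c - int k))) = h (c - int k)" by (rule hm)
  qed (simp_all only: lt atMost_iff)
qed

text \<open>Reversing the arguments of \<open>f\<close> multiplies it by \<open>- (-1) ^ r\<close>, so that the second sum enters with a
  minus sign and with the arguments of \<open>f\<close> in the natural order.\<close>

lemma ihara_circ_pspace:
  assumes f: "f \<in> pspace r"
  shows "ihara_circ r s f g =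
    (\<Sum>i=0..s. poly_subst (\<lambda>j. Y (i + j)) f * poly_subst (\<lambda>j. if j \<le> i then Y j else Y (j + r)) g)
    - (\<Sum>i=1..s. poly_subst (\<lambda>j. Y (i + j)) f * poly_subst (\<lambda>j. if j < i then Y j else Y (j + r)) g)"
proof -
  have rev: "poly_subst (\<lambda>j. Y (i + r - j)) f = - ((-1) ^ r * poly_subst (\<lambda>j. Y (i + j)) f)" for i
  proof -
    have "poly_subst (\<lambda>j. Y (i + r - j)) f = poly_subst (\<lambda>j. Y (i + (r - j))) f"
      by (rule poly_subst_cong[OF pspace_polys[OF f]]) simp
    then show ?thesis
      by (simp only: pspace_reverse[OF f, of "\<lambda>j. Y (i + j)"])
  qed
  let ?L = "\<lambda>f. (\<Sum>i=0..s. poly_subst (\<lambda>j. Y (i + j)) f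
               * poly_subst (\<lambda>j. if j \<le> i then Y j else Y (j + r)) g)
     + (-1) ^ r
       * (\<Sum>i=1..s. poly_subst (\<lambda>j. Y (i + r - j)) f
                  * poly_subst (\<lambda>j. if j < i then Y j else Y (j + r)) g)"
  have "ihara_circ r s f g = ?L f"
    unfolding ihara_circ_def using pspace_even[OF f]
    by (intro hom_extend_eq[where G = ?L])
      (auto simp: even_polys_def power_add poly_subst_add sum.distrib algebra_simps)
  then show ?thesis
    by (simp add: rev sum_negf sum_distrib_left flip: mult.assoc power_add mult_2)
qed

text \<open>The variables that are left for \<open>g\<close> after the removal of an arc form an arc again once they are
  listed in their cyclic order, and the rotation invariance of \<open>g\<close> allows them to be listed in this way.\<close>

lemma ihara_circ_cyclic:
  assumes f: "f \<in> pspace r" and g: "g \<in> pspace s"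
  defines "F \<equiv> window (r + s) f" and "G \<equiv> window (r + s) g"
  shows "ihara_circ r s f g =
    (\<Sum>i=0..s. F (int i) * G (int i + int r + 1)) - (\<Sum>i=1..s. F (int i) * G (int i + int r))"
proof -
  let ?n = "r + s"
  have F: "poly_subst (\<lambda>j. Y (i + j)) f = F (int i)" if "i \<le> s" for i
    unfolding F_def window_def
    by (rule poly_subst_cong[OF pspace_polys[OF f]]) (use that in \<open>simp flip: of_nat_add add: Yc_nat\<close>)
  have Yi: "Yc ?n (int i + int r + 1 + int j) = Y (Suc (i + r + j) mod Suc ?n)"
    "Yc ?n (int i + int r + int j) = Y ((i + r + j) mod Suc ?n)" for i j
    by (simp_all add: Yc_def nat_mod_as_int algebra_simps)
  have G: "poly_subst (\<lambda>j. if j \<le> i then Y j else Y (j + r)) g = G (int i + int r + 1)" if "i \<le> s" for i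
    unfolding G_def window_def
    by (subst pspace_rotate[OF g, symmetric, of _ "Suc i"], rule poly_subst_cong[OF pspace_polys[OF g]])
      (use that in \<open>auto simp: Yi mod_if intro!: arg_cong[of _ _ Y]\<close>)
  have G': "poly_subst (\<lambda>j. if j < i then Y j else Y (j + r)) g = G (int i + int r)" if "i \<le> s" "1 \<le> i" for i
    unfolding G_def window_def
    by (subst pspace_rotate[OF g, symmetric, of _ "i"], rule poly_subst_cong[OF pspace_polys[OF g]])
      (use that in \<open>auto simp: Yi mod_if intro!: arg_cong[of _ _ Y]\<close>)
  show ?thesis
    unfolding ihara_circ_pspace[OF f]
    by (intro arg_cong2[of _ _ _ _ "(-)"] sum.cong refl) (simp_all add: F G G')
qed

text \<open>In \<open>g\<close> inserted into \<open>f\<close> the same products occur with \<open>f\<close> and \<open>g\<close> exchanged, and indexing them by the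
  position of \<open>f\<close> shows that they are exactly the products missing from \<open>f\<close> inserted into \<open>g\<close>.
  Together the two halves go once around the circle.\<close>

lemma ihara_bracket_cyclic:
  assumes f: "f \<in> pspace r" and g: "g \<in> pspace s"
  defines "F \<equiv> window (r + s) f" and "G \<equiv> window (r + s) g"
  shows "ihara_bracket r s f g =
    (\<Sum>k\<le>r + s. F (int k) * G (int k + int r + 1)) - (\<Sum>k\<le>r + s. F (int k) * G (int k + int r))"
proof -
  define P Q where "P k = F (int k) * G (int k + int r)" and "Q k = F (int k) * G (int k + int r + 1)" for k
  have per: "G (k + int (Suc (r + s))) = G k" "F (k + int (Suc (r + s))) = F k" for k
    unfolding F_def G_def by (rule window_cong, simp)+
  have Pi: "G (int i) * F (int i + int s + 1) = P (i + Suc s)" for i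
    using per(1)[of "int i"] by (simp add: P_def algebra_simps)
  have Qi: "G (int i) * F (int i + int s) = Q (i + s)" for i
    using per(1)[of "int i"] by (simp add: Q_def algebra_simps)
  \<comment> \<open>The two halves together use \<open>P\<close> at the positions 1, ..., \<open>r + s + 1\<close>, not 0, ..., \<open>r + s\<close>.\<close>
  have PN: "P (Suc (r + s)) = P 0"
    using per(2)[of 0] per(1)[of "int r"] by (simp add: P_def algebra_simps)
  have fg: "ihara_circ r s f g = sum Q {0..s} - sum P {1..s}"
    by (simp add: ihara_circ_cyclic[OF f g] P_def Q_def F_def G_def)
  have "ihara_circ s r g f = (\<Sum>i=0..r. P (i + Suc s)) - (\<Sum>i=1..r. Q (i + s))"
    by (simp only: ihara_circ_cyclic[OF g f] Pi[symmetric] Qi[symmetric] F_def G_def add.commute[of s r])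
  also have "\<dots> = sum P {Suc s..Suc (r + s)} - sum Q {Suc s..r + s}"
    by (simp only: sum.shift_bounds_cl_nat_ivl[symmetric]) simp
  finally have gf: "ihara_circ s r g f = \<dots>" .
  have q1: "sum Q {0..s} + sum Q {Suc s..r + s} = sum Q {..r + s}"
    using sum.ub_add_nat[of 0 s Q r] by (simp add: add.commute atMost_atLeast0)
  have p1: "sum P {1..s} + sum P {Suc s..Suc (r + s)} = sum P {1..Suc (r + s)}"
    using sum.ub_add_nat[of 1 s P "Suc r"] by (simp add: add.commute)
  have p2: "sum P {1..Suc (r + s)} = sum P {..r + s}"
  proof -
    have "sum P {1..Suc (r + s)} + P 0 = sum P {..Suc (r + s)}"
      using sum.atLeast_Suc_atMost[of 0 "Suc (r + s)" P] by (simp add: atMost_atLeast0 del: sum.cl_ivl_Suc)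
    then show ?thesis by (simp only: sum.atMost_Suc PN add_right_cancel)
  qed
  have "ihara_bracket r s f g = sum Q {..r + s} - sum P {..r + s}"
    unfolding ihara_bracket_def fg gf q1[symmetric] p2[symmetric] p1[symmetric] by (simp add: algebra_simps)
  then show ?thesis by (simp only: P_def[abs_def] Q_def[abs_def])
qed

lemma Yc_polys: "Yc n i \<in> polys n"
proof -
  have "nat (i mod int (Suc n)) \<le> n" using pos_mod_bound[of "int (Suc n)" i] by linarith
  then show ?thesis by (simp add: Yc_def polys_Y)
qed

lemma Yc_diff: "i \<le> m \<Longrightarrow> m - i \<le> n \<Longrightarrow> Yc n (int m - int i) = Y (m - i)"
  by (simp add: Yc_nat flip: of_nat_diff)

lemma subst_Yc: "poly_subst (\<lambda>i. Yc n (k + a * int i)) (Yc n z) = Yc n (k + a * z)"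
proof -
  have "(k + a * int (nat (z mod int (Suc n)))) mod int (Suc n) = (k + a * z) mod int (Suc n)"
    by (simp del: of_nat_Suc) (metis mod_add_right_eq mod_mult_right_eq)
  then show ?thesis by (simp only: Yc_def[of n z] poly_subst_Y) (rule Yc_cong)
qed

lemma subst_neg_subst_Yc:
  assumes "f \<in> even_polys r"
  shows "poly_subst (\<lambda>i. - Y i) (poly_subst (\<lambda>i. Y (p i)) f) = poly_subst (\<lambda>i. Y (p i)) f"
proof -
  have "poly_subst (\<lambda>i. - Y i) (poly_subst (\<lambda>i. Y (p i)) f)
     = poly_subst (\<lambda>i. Y (p i)) (poly_subst (\<lambda>i. - Y i) f)"
    by (simp add: poly_subst_poly_subst poly_subst_uminus)
  then show ?thesis using assms by (simp add: even_polys_iff)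
qed

lemma subst_Yc_even:
  assumes "f \<in> even_polys r"
  shows "poly_subst (\<lambda>i. Yc n (p i)) f \<in> even_polys n"
  using assms subst_neg_subst_Yc[OF assms] polys_subst[of f r "\<lambda>i. Yc n (p i)" n]
  by (simp add: even_polys_iff Yc_polys) (simp add: Yc_def)

lemma even_polys_mult: "f \<in> even_polys n \<Longrightarrow> g \<in> even_polys n \<Longrightarrow> f * g \<in> even_polys n"
  by (simp add: even_polys_iff polys_mult poly_subst_mult)

lemma even_polys_add: "f \<in> even_polys n \<Longrightarrow> g \<in> even_polys n \<Longrightarrow> f + g \<in> even_polys n"
  by (simp add: even_polys_iff polys_add poly_subst_add)

lemma even_polys_zero [simp]: "0 \<in> even_polys n"
  by (simp add: even_polys_iff)

lemma even_polys_diff: "f \<in> even_polys n \<Longrightarrow> g \<in> even_polys n \<Longrightarrow> f - g \<in> even_polys n"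
  by (simp add: even_polys_iff polys_diff poly_subst_diff)

lemma even_polys_sum: "(\<And>i. i \<in> A \<Longrightarrow> f i \<in> even_polys n) \<Longrightarrow> sum f A \<in> even_polys n"
  by (induction A rule: infinite_finite_induct) (simp_all add: even_polys_add)

lemma even_polys_sign: "f \<in> even_polys n \<Longrightarrow> (-1) ^ k * f \<in> even_polys n"
  by (simp add: even_polys_iff polys_mult polys_neg_one_power poly_subst_mult poly_subst_neg_one_power)

lemma window_even: "f \<in> even_polys r \<Longrightarrow> window n f k \<in> even_polys n"
  unfolding window_def by (rule subst_Yc_even)

lemma window_reflect:
  assumes "f \<in> pspace r"
  shows "poly_subst (\<lambda>i. Yc n (c - int i)) (window n f k) = - ((-1) ^ r * window n f (c - k - int r))"
proof -
  have "poly_subst (\<lambda>i. Yc n (c - int i)) (window n f k) = poly_subst (\<lambda>j. Yc n (c - k - int j)) f"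
    using subst_Yc[of n c "-1"] by (simp add: window_def poly_subst_poly_subst algebra_simps)
  also have "\<dots> = poly_subst (\<lambda>j. (\<lambda>i. Yc n (c - k - int r + int i)) (r - j)) f"
    by (rule poly_subst_cong[OF pspace_polys[OF assms]]) (simp add: of_nat_diff algebra_simps)
  also have "\<dots> = - ((-1) ^ r * window n f (c - k - int r))"
    unfolding window_def by (rule pspace_reverse[OF assms])
  finally show ?thesis .
qed

text \<open>A reflection of the circle moves the point shared by the two arcs from the end of the arc of \<open>f\<close>
  to its beginning. This exchanges the two families of products.\<close>

lemma reflect_products:
  assumes f: "f \<in> pspace r" and g: "g \<in> pspace s"
  defines "F \<equiv> window (r + s) f" and "G \<equiv> window (r + s) g"
  defines "P \<equiv> \<lambda>k. F k * G (k + int r)" and "Q \<equiv> \<lambda>k. F k * G (k + int r + 1)"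
  shows "poly_subst (\<lambda>i. Yc (r + s) (c - int i)) (P k) = (-1) ^ (r + s) * Q (c - int r - k)"
    and "poly_subst (\<lambda>i. Yc (r + s) (c - int i)) (Q k) = (-1) ^ (r + s) * P (c - int r - k)"
proof -
  have c1: "G (c - (k + int r) - int s) = G (c - int r - k + int r + 1)"
    unfolding G_def by (rule window_cong, simp add: mod_eq_dvd_iff, rule dvdI[of _ _ "-1"], simp)
  have c2: "G (c - (k + int r + 1) - int s) = G (c - int r - k + int r)"
    unfolding G_def by (rule window_cong, simp add: mod_eq_dvd_iff, rule dvdI[of _ _ "-1"], simp)
  have c3: "F (c - k - int r) = F (c - int r - k)" by (simp add: algebra_simps)
  note R = window_reflect[OF f, of "r + s" c, folded F_def] window_reflect[OF g, of "r + s" c, folded G_def]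
  show "poly_subst (\<lambda>i. Yc (r + s) (c - int i)) (P k) = (-1) ^ (r + s) * Q (c - int r - k)"
    unfolding P_def Q_def poly_subst_mult R c1 c3 by (simp add: power_add)
  show "poly_subst (\<lambda>i. Yc (r + s) (c - int i)) (Q k) = (-1) ^ (r + s) * P (c - int r - k)"
    unfolding P_def Q_def poly_subst_mult R c2 c3 by (simp add: power_add)
qed

lemma products_mod:
  "window n f (k mod int (Suc n)) * window n g (k mod int (Suc n) + int r) = window n f k * window n g (k + int r)"
  "window n f (k mod int (Suc n)) * window n g (k mod int (Suc n) + int r + 1) = window n f k * window n g (k + int r + 1)"
  using window_mod[of n f k 0] window_mod[of n g k "int r"] window_mod[of n g k "int r + 1"]
  by (simp_all add: add.assoc)

lemma bracket_reflect:
  assumes f: "f \<in> pspace r" and g: "g \<in> pspace s"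
  shows "poly_subst (\<lambda>i. Yc (r + s) (c - int i)) (ihara_bracket r s f g) = - ((-1) ^ (r + s) * ihara_bracket r s f g)"
proof -
  define P Q where "P k = window (r + s) f k * window (r + s) g (k + int r)"
    and "Q k = window (r + s) f k * window (r + s) g (k + int r + 1)" for k
  have B: "ihara_bracket r s f g = (\<Sum>k\<le>r + s. Q (int k)) - (\<Sum>k\<le>r + s. P (int k))"
    unfolding P_def Q_def by (rule ihara_bracket_cyclic[OF f g])
  have S: "(\<Sum>k\<le>r + s. P (c - int r - int k)) = (\<Sum>k\<le>r + s. P (int k))"
    "(\<Sum>k\<le>r + s. Q (c - int r - int k)) = (\<Sum>k\<le>r + s. Q (int k))"
    by (rule sum_periodic; simp only: P_def Q_def products_mod)+
  let ?v = "\<lambda>i. Yc (r + s) (c - int i)"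
  have R: "poly_subst ?v (P (int k)) = (-1) ^ (r + s) * Q (c - int r - int k)"
    "poly_subst ?v (Q (int k)) = (-1) ^ (r + s) * P (c - int r - int k)" for k
    unfolding P_def Q_def by (rule reflect_products[OF f g])+
  have "poly_subst ?v (ihara_bracket r s f g)
    = (\<Sum>k\<le>r + s. poly_subst ?v (Q (int k))) - (\<Sum>k\<le>r + s. poly_subst ?v (P (int k)))"
    by (simp only: B poly_subst_diff poly_subst_sum)
  also have "\<dots> = (-1) ^ (r + s) * (\<Sum>k\<le>r + s. P (int k)) - (-1) ^ (r + s) * (\<Sum>k\<le>r + s. Q (int k))"
    by (simp only: R S sum_distrib_left[symmetric])
  finally show ?thesis by (simp only: B right_diff_distrib minus_diff_eq)
qed

text \<open>Both \<open>sigma\<close> and \<open>tau\<close> are reflections of the circle, up to the sign \<open>(-1) ^ (r + s)\<close>.\<close>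

lemma bracket_pspace:
  assumes f: "f \<in> pspace r" and g: "g \<in> pspace s"
  shows "ihara_bracket r s f g \<in> pspace (r + s)"
proof -
  let ?B = "ihara_bracket r s f g" and ?n = "r + s"
  have ev: "?B \<in> even_polys ?n"
    unfolding ihara_bracket_cyclic[OF f g]
    by (intro even_polys_diff even_polys_sum even_polys_mult window_even[OF pspace_even[OF f]] window_even[OF pspace_even[OF g]])
  then have p: "?B \<in> polys ?n" by (simp add: even_polys_iff)
  have "poly_subst (\<lambda>i. Y (?n - i)) ?B = - ((-1) ^ ?n * ?B)"
    unfolding bracket_reflect[OF f g, of "int ?n", symmetric]
    by (rule poly_subst_cong[OF p]) (simp only: Yc_diff diff_le_self)
  moreover have "poly_subst (\<lambda>i. if i = 0 then Y 0 else Y (?n + 1 - i)) ?B = - ((-1) ^ ?n * ?B)"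
    unfolding bracket_reflect[OF f g, of 0, symmetric]
  proof (rule poly_subst_cong[OF p])
    fix i assume "i \<le> ?n"
    moreover have "Yc ?n (0 - int i) = Yc ?n (int (?n + 1) - int i)"
      by (rule Yc_cong) (simp add: mod_eq_dvd_iff)
    ultimately show "(if i = 0 then Y 0 else Y (?n + 1 - i)) = Yc ?n (0 - int i)"
      by (cases "i = 0") (simp_all add: Yc_diff Yc_nat[of 0, simplified] del: of_nat_add of_nat_Suc)
  qed
  ultimately show ?thesis
    using ev by (simp only: pspace_iff neg_one_power_cancel) simp
qed

lemma homogeneous_window: "homogeneous d f \<Longrightarrow> homogeneous d (window n f k)"
  unfolding window_def by (rule homogeneous_subst) (simp_all add: Yc_def homogeneous_Y[simplified])

lemma bracket_homogeneous:
  assumes "f \<in> pspace r" "g \<in> pspace s" "homogeneous d f" "homogeneous e g"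
  shows "homogeneous (d + e) (ihara_bracket r s f g)"
  unfolding ihara_bracket_cyclic[OF assms(1,2)] using assms(3,4)
  by (intro homogeneous_diff homogeneous_sum homogeneous_mult homogeneous_window)

section \<open>The dihedral group and its orientation character\<close>

text \<open>The sign with which an element acts on polynomials, in addition to permuting the variables; here
  \<open>a = 1\<close> stands for rotations and \<open>a = -1\<close> for reflections.\<close>

definition reflection_sign :: "nat \<Rightarrow> int \<Rightarrow> qpoly" where
  "reflection_sign n a = (if a = 1 then 1 else (-1) ^ n)"

text \<open>The elements of the dihedral group in coordinates: the point \<open>i\<close> of the circle goes to \<open>k + a * i\<close>
  modulo \<open>n + 1\<close>, with \<open>a\<close> equal to 1 or -1. Composition becomes composition of affine maps.\<close>

definition dihedral_op :: "nat \<Rightarrow> int \<Rightarrow> int \<Rightarrow> qpoly \<Rightarrow> qpoly" where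
  "dihedral_op n a k = (\<lambda>h\<in>even_polys n. reflection_sign n a * poly_subst (\<lambda>i. Yc n (k + a * int i)) h)"

abbreviation units :: "int set" where "units \<equiv> {1, -1}"

lemma reflection_sign_mult: "a \<in> units \<Longrightarrow> b \<in> units \<Longrightarrow> reflection_sign n (a * b) = reflection_sign n a * reflection_sign n b"
  by (auto simp: reflection_sign_def simp flip: power_add mult_2)

lemma reflection_sign_sign: "\<exists>k. reflection_sign n a = (-1) ^ k"
  unfolding reflection_sign_def by (metis power_0)

lemma poly_subst_reflection_sign: "poly_subst v (reflection_sign n a) = reflection_sign n a"
  by (metis reflection_sign_sign poly_subst_neg_one_power)

lemma dihedral_op_even:
  assumes "h \<in> even_polys n"
  shows "dihedral_op n a k h \<in> even_polys n"
  using assms subst_Yc_even[OF assms, of n "\<lambda>i. k + a * int i"]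
  by (cases "a = 1") (simp_all add: dihedral_op_def reflection_sign_def even_polys_sign)

lemma dihedral_op_cong: "k mod int (Suc n) = l mod int (Suc n) \<Longrightarrow> dihedral_op n a k = dihedral_op n a l"
  unfolding dihedral_op_def
  by (intro restrict_ext arg_cong2[of _ _ _ _ "(*)"] arg_cong2[of _ _ _ _ poly_subst] refl ext Yc_cong)
    (metis mod_add_left_eq)

lemma dihedral_op_compose:
  assumes "a \<in> units" "b \<in> units"
  shows "compose (even_polys n) (dihedral_op n a k) (dihedral_op n b l) = dihedral_op n (a * b) (k + a * l)"
proof (rule extensionalityI[of _ "even_polys n"])
  fix h assume h: "h \<in> even_polys n"
  then show "compose (even_polys n) (dihedral_op n a k) (dihedral_op n b l) h = dihedral_op n (a * b) (k + a * l) h"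
    using dihedral_op_even[OF h, of b l]
    by (simp add: compose_eq dihedral_op_def poly_subst_mult poly_subst_reflection_sign poly_subst_poly_subst subst_Yc
        reflection_sign_mult[OF assms] algebra_simps)
qed (simp_all add: dihedral_op_def compose_extensional)

lemma dihedral_op_one: "dihedral_op n 1 0 = (\<lambda>h\<in>even_polys n. h)"
  unfolding dihedral_op_def reflection_sign_def
proof (rule restrict_ext)
  fix h assume "h \<in> even_polys n"
  then have "poly_subst (\<lambda>i. Yc n (0 + 1 * int i)) h = poly_subst Y h"
    by (intro poly_subst_cong[of h n]) (auto simp: even_polys_iff Yc_nat)
  then show "(if (1::int) = 1 then 1 else (-1) ^ n) * poly_subst (\<lambda>i. Yc n (0 + 1 * int i)) h = h"
    by simp
qed

lemma dihedral_op_inverse: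
  assumes "a \<in> units"
  shows "compose (even_polys n) (dihedral_op n a k) (dihedral_op n a (- a * k)) = (\<lambda>h\<in>even_polys n. h)"
    and "compose (even_polys n) (dihedral_op n a (- a * k)) (dihedral_op n a k) = (\<lambda>h\<in>even_polys n. h)"
  using assms by (auto simp: dihedral_op_compose dihedral_op_one)

lemma dihedral_op_Bij: "a \<in> units \<Longrightarrow> dihedral_op n a k \<in> Bij (even_polys n)"
proof -
  assume a: "a \<in> units"
  have "dihedral_op n a (- a * k) (dihedral_op n a k h) = h" "dihedral_op n a k (dihedral_op n a (- a * k) h) = h" if "h \<in> even_polys n" for h
    using dihedral_op_inverse[OF a, of n k, THEN fun_cong, of h] that by (simp_all add: compose_eq)
  then have "bij_betw (dihedral_op n a k) (even_polys n) (even_polys n)"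
    by (intro bij_betw_byWitness[where f' = "dihedral_op n a (- a * k)"]) (auto simp: dihedral_op_even)
  then show ?thesis by (simp add: Bij_def dihedral_op_def)
qed

lemma dihedral_op_mult:
  "a \<in> units \<Longrightarrow> b \<in> units \<Longrightarrow> dihedral_op n a k \<otimes>\<^bsub>BijGroup (even_polys n)\<^esub> dihedral_op n b l = dihedral_op n (a * b) (k + a * l)"
  by (simp add: BijGroup_def dihedral_op_Bij dihedral_op_compose del: insert_iff)

lemma dihedral_sigma_eq: "dihedral_sigma n = dihedral_op n (-1) (int n)"
  unfolding dihedral_sigma_def dihedral_op_def reflection_sign_def
  by (rule restrict_ext, simp, rule poly_subst_cong[of _ n])
    (auto simp: even_polys_iff Yc_def simp flip: of_nat_diff)

lemma Yc_neg: "i \<le> n \<Longrightarrow> Yc n (- int i) = (if i = 0 then Y 0 else Y (n + 1 - i))"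
proof -
  assume "i \<le> n"
  moreover have "Yc n (- int i) = Yc n (int (n + 1) - int i)"
    by (rule Yc_cong) (simp add: mod_eq_dvd_iff)
  ultimately show ?thesis
    by (cases "i = 0") (simp_all add: Yc_diff Yc_nat[of 0, simplified] del: of_nat_add of_nat_Suc)
qed

lemma dihedral_tau_eq: "dihedral_tau n = dihedral_op n (-1) 0"
  unfolding dihedral_tau_def dihedral_op_def reflection_sign_def
  by (rule restrict_ext, simp, rule poly_subst_cong[of _ n]) (simp_all add: even_polys_iff Yc_neg)

lemma carrier_dihedral_subset: "carrier (dihedral n) \<subseteq> {dihedral_op n a k | a k. a \<in> units}"
proof -
  let ?G = "BijGroup (even_polys n)" and ?H = "{dihedral_op n a k | a k. a \<in> units}"
  interpret group ?G by (rule group_BijGroup)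
  have "subgroup ?H ?G"
  proof (rule subgroupI)
    show "?H \<subseteq> carrier ?G" using dihedral_op_Bij by (auto simp: BijGroup_def simp del: insert_iff)
    show "?H \<noteq> {}" by auto
    show "inv\<^bsub>?G\<^esub> x \<in> ?H" if x: "x \<in> ?H" for x
    proof -
      obtain a k where a: "a \<in> units" "x = dihedral_op n a k" using x by blast
      have "inv\<^bsub>?G\<^esub> x = dihedral_op n a (- a * k)"
        using a dihedral_op_inverse(2)[of a n k] dihedral_op_Bij[of a n]
        by (intro inv_equality) (simp_all add: BijGroup_def)
      then show ?thesis using a by blast
    qed
    show "x \<otimes>\<^bsub>?G\<^esub> y \<in> ?H" if xy: "x \<in> ?H" "y \<in> ?H" for x y
    proof -
      obtain a k b l where a: "a \<in> units" "x = dihedral_op n a k" "b \<in> units" "y = dihedral_op n b l" using xy by blast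
      then have "x \<otimes>\<^bsub>?G\<^esub> y = dihedral_op n (a * b) (k + a * l)" "a * b \<in> units" by (auto simp: dihedral_op_mult)
      then show ?thesis by blast
    qed
  qed
  then show ?thesis
    unfolding dihedral_def
    by (rule subgroup_generated_minimal) (auto simp: dihedral_sigma_eq dihedral_tau_eq)
qed

lemma dihedral_cases:
  assumes "x \<in> carrier (dihedral n)"
  obtains a k where "a \<in> units" "x = dihedral_op n a k"
  using subsetD[OF carrier_dihedral_subset assms] that by blast

lemma dihedral_mult: "monoid.mult (dihedral n) = monoid.mult (BijGroup (even_polys n))"
  by (simp add: dihedral_def)

lemma dihedral_one: "\<one>\<^bsub>dihedral n\<^esub> = dihedral_op n 1 0"
  by (simp add: dihedral_def dihedral_op_one) (simp add: BijGroup_def)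

text \<open>The composition of the two generators is the rotation by one step. Hence they generate all rotations,
  and a character with the value -1 on both of them is trivial on rotations.\<close>

lemma dihedral_rotate_step:
  "dihedral_op n 1 (int (Suc m)) = dihedral_op n 1 (int m) \<otimes>\<^bsub>dihedral n\<^esub> (dihedral_tau n \<otimes>\<^bsub>dihedral n\<^esub> dihedral_sigma n)"
proof -
  have "dihedral_op n 1 (int (Suc m)) = dihedral_op n 1 (int m + 1 * (0 + (-1) * int n))"
    by (rule dihedral_op_cong) (simp add: mod_eq_dvd_iff)
  then show ?thesis by (simp add: dihedral_mult dihedral_sigma_eq dihedral_tau_eq dihedral_op_mult)
qed

lemma dihedral_reflect_step:
  "dihedral_op n (-1) k = dihedral_op n 1 k \<otimes>\<^bsub>dihedral n\<^esub> dihedral_tau n"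
  by (simp add: dihedral_mult dihedral_tau_eq dihedral_op_mult)

lemma group_dihedral: "group (dihedral n)"
  unfolding dihedral_def by (simp add: group.group_subgroup_generated group_BijGroup)

lemma dihedral_generators: "dihedral_sigma n \<in> carrier (dihedral n)" "dihedral_tau n \<in> carrier (dihedral n)"
proof -
  have "{dihedral_sigma n, dihedral_tau n} \<subseteq> carrier (dihedral n)"
    unfolding dihedral_def
    by (rule group.subgroup_generated_subset_carrier_subset[OF group_BijGroup])
      (auto simp: dihedral_sigma_eq dihedral_tau_eq BijGroup_def intro: dihedral_op_Bij)
  then show "dihedral_sigma n \<in> carrier (dihedral n)" "dihedral_tau n \<in> carrier (dihedral n)" by auto
qed

lemma dihedral_op_reduce: "dihedral_op n a k = dihedral_op n a (int (nat (k mod int (Suc n))))"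
  by (rule dihedral_op_cong) simp

lemma dihedral_op_carrier: assumes "a \<in> units" shows "dihedral_op n a k \<in> carrier (dihedral n)"
proof -
  interpret group "dihedral n" by (rule group_dihedral)
  have rot: "dihedral_op n 1 (int m) \<in> carrier (dihedral n)" for m
  proof (induction m)
    case 0
    show ?case using one_closed by (simp add: dihedral_one)
  next
    case (Suc m)
    then show ?case unfolding dihedral_rotate_step by (intro m_closed dihedral_generators)
  qed
  then have "dihedral_op n 1 k \<in> carrier (dihedral n)" for k by (subst dihedral_op_reduce)
  then show ?thesis
    using assms dihedral_reflect_step[of n k] dihedral_generators(2) by auto
qed

lemma carrier_dihedral: "carrier (dihedral n) = (\<lambda>(a, k). dihedral_op n a (int k)) ` (units \<times> {..n})"
proof -
  have "dihedral_op n a k \<in> (\<lambda>(a, k). dihedral_op n a (int k)) ` (units \<times> {..n})" if "a \<in> units" for a k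
  proof (rule image_eqI[where x = "(a, nat (k mod int (Suc n)))"])
    show "dihedral_op n a k = (case (a, nat (k mod int (Suc n))) of (a, k) \<Rightarrow> dihedral_op n a (int k))"
      unfolding prod.case by (rule dihedral_op_reduce)
    have "nat (k mod int (Suc n)) \<le> n"
      using pos_mod_bound[of "int (Suc n)" k] by linarith
    with that show "(a, nat (k mod int (Suc n))) \<in> units \<times> {..n}" by (simp del: of_nat_Suc)
  qed
  then have "carrier (dihedral n) \<subseteq> (\<lambda>(a, k). dihedral_op n a (int k)) ` (units \<times> {..n})"
    by (auto elim!: dihedral_cases simp del: insert_iff)
  moreover have "(\<lambda>(a, k). dihedral_op n a (int k)) ` (units \<times> {..n}) \<subseteq> carrier (dihedral n)"
    using dihedral_op_carrier by (auto simp del: insert_iff)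
  ultimately show ?thesis by (rule equalityI)
qed

text \<open>The squares of the variables are even, and their images show the underlying permutation; the sign does
  not affect the set of monomials.\<close>

lemma dihedral_op_square_keys:
  assumes "j \<le> n"
  shows "Poly_Mapping.keys (dihedral_op n a k ((Y j)\<^sup>2)) =
    {Poly_Mapping.single (nat ((k + a * int j) mod int (Suc n))) (2::nat)}"
proof -
  have sq: "(Y i)\<^sup>2 = Poly_Mapping.single (Poly_Mapping.single i 2) 1" for i
    by (simp add: Y_def power2_eq_square mult_single single_add[symmetric] numeral_2_eq_2)
  have "(Y j)\<^sup>2 \<in> even_polys n"
    using assms by (simp add: even_polys_iff polys_power polys_Y poly_subst_power)
  then have "dihedral_op n a k ((Y j)\<^sup>2) = reflection_sign n a * (Yc n (k + a * int j))\<^sup>2"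
    by (simp add: dihedral_op_def poly_subst_power)
  moreover have "Poly_Mapping.keys (reflection_sign n a * h) = Poly_Mapping.keys h" for h
    unfolding reflection_sign_def by (cases "even n") simp_all
  ultimately show ?thesis by (simp add: Yc_def sq del: of_nat_Suc)
qed

text \<open>The images of the points 0 and 1 determine \<open>k\<close> and \<open>k + a\<close> modulo \<open>n + 1\<close>. The values 1 and -1 of
  \<open>a\<close> are different modulo \<open>n + 1\<close> because \<open>n \<ge> 2\<close>.\<close>

lemma dihedral_op_eqD:
  assumes n: "n \<ge> 2" and ab: "a \<in> units" "b \<in> units" and eq: "dihedral_op n a k = dihedral_op n b l"
  shows "a = b \<and> k mod int (Suc n) = l mod int (Suc n)"
proof -
  let ?N = "int (Suc n)"
  have single_eq: "i = j" if "Poly_Mapping.single i (2::nat) = Poly_Mapping.single j 2" for i j :: nat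
    using arg_cong[OF that, of Poly_Mapping.keys] by simp
  have m: "(k + a * int j) mod ?N = (l + b * int j) mod ?N" if "j \<le> n" for j
  proof -
    have "nat ((k + a * int j) mod ?N) = nat ((l + b * int j) mod ?N)"
      using dihedral_op_square_keys[OF that, of a k] dihedral_op_square_keys[OF that, of b l] eq
      by (intro single_eq) (simp del: of_nat_Suc)
    then show ?thesis by (simp add: nat_eq_iff del: of_nat_Suc)
  qed
  have kl: "k mod ?N = l mod ?N" using m[of 0] by simp
  have "(k + a) mod ?N = (k + b) mod ?N"
    using m[of 1] n mod_add_cong[OF kl refl, of b] by simp
  then have "?N dvd a - b" by (simp add: mod_eq_dvd_iff)
  moreover have "a - b \<in> {0, 2, -2}" using ab by auto
  ultimately have "a = b" using n zdvd_imp_le[of ?N 2] by auto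
  with kl show ?thesis by simp
qed

lemma sum_dihedral:
  assumes "n \<ge> 2"
  shows "(\<Sum>\<mu>\<in>carrier (dihedral n). \<phi> \<mu>) =
    (\<Sum>k\<le>n. \<phi> (dihedral_op n 1 (int k))) + (\<Sum>k\<le>n. \<phi> (dihedral_op n (-1) (int k)))"
proof -
  have "inj_on (\<lambda>(a, k). dihedral_op n a (int k)) (units \<times> {..n})"
  proof (rule inj_onI)
    fix x y :: "int \<times> nat"
    assume "x \<in> units \<times> {..n}" "y \<in> units \<times> {..n}"
      and "(\<lambda>(a, k). dihedral_op n a (int k)) x = (\<lambda>(a, k). dihedral_op n a (int k)) y"
    then show "x = y"
      using dihedral_op_eqD[OF assms, of "fst x" "fst y" "int (snd x)" "int (snd y)"]
      by (auto simp: case_prod_beta prod_eq_iff simp del: of_nat_Suc)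
  qed
  then show ?thesis
    unfolding carrier_dihedral
    by (subst sum.reindex) (simp_all add: sum.cartesian_product' comp_def case_prod_unfold)
qed

text \<open>The coordinate \<open>a\<close> is multiplicative, and it is well defined since the coordinates are unique.\<close>

lemma orientation_exists:
  assumes n: "n \<ge> 2"
  shows "\<exists>e. is_orientation_character n e"
proof -
  define e :: "(qpoly \<Rightarrow> qpoly) \<Rightarrow> int" where "e = (\<lambda>\<mu>. if \<exists>k. \<mu> = dihedral_op n 1 k then 1 else -1)"
  have e: "e (dihedral_op n a k) = a" if "a \<in> units" for a k
    using that dihedral_op_eqD[OF n that, of 1] by (auto simp: e_def)
  have "e \<in> hom (dihedral n) sign_img"
  proof (rule homI)
    fix x assume "x \<in> carrier (dihedral n)"
    show "e x \<in> carrier sign_img" by (simp add: e_def sign_img_def)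
  next
    fix x y assume xy: "x \<in> carrier (dihedral n)" "y \<in> carrier (dihedral n)"
    from xy(1) obtain a k where 1: "a \<in> units" "x = dihedral_op n a k" by (rule dihedral_cases)
    from xy(2) obtain b l where 2: "b \<in> units" "y = dihedral_op n b l" by (rule dihedral_cases)
    note a = 1 2
    moreover have "a * b \<in> units" using a by auto
    ultimately show "e (x \<otimes>\<^bsub>dihedral n\<^esub> y) = e x \<otimes>\<^bsub>sign_img\<^esub> e y"
      by (simp add: dihedral_mult dihedral_op_mult e sign_img_def del: insert_iff)
  qed
  then have "is_orientation_character n e"
    by (simp add: is_orientation_character_def dihedral_sigma_eq dihedral_tau_eq e)
  then show ?thesis by blast
qed

lemma orientation_dihedral_op:
  assumes n: "n \<ge> 2" and a: "a \<in> units"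
  shows "orientation n (dihedral_op n a k) = a"
proof -
  interpret group "dihedral n" by (rule group_dihedral)
  let ?e = "orientation n"
  have e: "is_orientation_character n ?e"
    unfolding orientation_def by (rule someI_ex[OF orientation_exists[OF n]])
  then have mult: "?e (x \<otimes>\<^bsub>dihedral n\<^esub> y) = ?e x * ?e y"
    if "x \<in> carrier (dihedral n)" "y \<in> carrier (dihedral n)" for x y
    using that hom_mult[of ?e "dihedral n" sign_img x y]
    unfolding is_orientation_character_def by (simp add: sign_img_def)
  have gen: "?e (dihedral_sigma n) = -1" "?e (dihedral_tau n) = -1"
    using e by (simp_all add: is_orientation_character_def)
  have one: "?e \<one>\<^bsub>dihedral n\<^esub> = 1"
    using e group_hom.hom_one[of "dihedral n" sign_img ?e] group_axioms sign_img_is_group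
    by (simp add: is_orientation_character_def group_hom_def group_hom_axioms_def sign_img_def)
  have "?e (dihedral_op n 1 (int m)) = 1" for m
  proof (induction m)
    case 0
    show ?case using one by (simp add: dihedral_one)
  next
    case (Suc m)
    then show ?case
      unfolding dihedral_rotate_step
      by (simp add: mult gen dihedral_generators dihedral_op_carrier)
  qed
  then have rot: "?e (dihedral_op n 1 k) = 1" for k by (subst dihedral_op_reduce)
  show ?thesis
    using a by (auto simp: rot dihedral_reflect_step mult gen dihedral_generators dihedral_op_carrier)
qed

text \<open>The product in question is the product at position 0. Rotations carry it to the products of the first
  family at all positions, reflections carry it to those of the second family, and the values of the
  orientation character are the signs in \<open>ihara_bracket_cyclic\<close>, up to the global sign.\<close>

theorem bracket_dihedral_sum:
  assumes rs: "r \<ge> 1" "s \<ge> 1" and f: "f \<in> pspace r" and g: "g \<in> pspace s"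
  shows "ihara_bracket r s f g = - (\<Sum>\<mu>\<in>carrier (dihedral (r + s)).
     of_int (orientation (r + s) \<mu>) * \<mu> (f * poly_subst (\<lambda>j. Y (r + j)) g))"
proof -
  let ?n = "r + s" and ?h = "f * poly_subst (\<lambda>j. Y (r + j)) g"
  have n: "?n \<ge> 2" using rs by simp
  define P Q where "P k = window ?n f k * window ?n g (k + int r)"
    and "Q k = window ?n f k * window ?n g (k + int r + 1)" for k
  have h: "?h = P 0"
  proof -
    have "poly_subst Y f = window ?n f 0"
      unfolding window_def by (rule poly_subst_cong[OF pspace_polys[OF f]]) (simp add: Yc_nat)
    moreover have "poly_subst (\<lambda>j. Y (r + j)) g = window ?n g (int r)"
      unfolding window_def by (rule poly_subst_cong[OF pspace_polys[OF g]]) (simp add: Yc_nat flip: of_nat_add)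
    ultimately show ?thesis by (simp add: P_def)
  qed
  have ev: "P 0 \<in> even_polys ?n"
    unfolding P_def by (intro even_polys_mult window_even[OF pspace_even[OF f]] window_even[OF pspace_even[OF g]])
  have "dihedral_op ?n 1 k (P 0) = P k" for k
    using ev subst_Yc[of ?n k 1]
    by (simp add: dihedral_op_def reflection_sign_def) (simp add: P_def poly_subst_mult window_def poly_subst_poly_subst algebra_simps)
  moreover have "dihedral_op ?n (-1) k (P 0) = Q (k - int r)" for k
  proof -
    have "dihedral_op ?n (-1) k (P 0) = (-1) ^ ?n * poly_subst (\<lambda>i. Yc ?n (k - int i)) (P 0)"
      using ev by (simp add: dihedral_op_def reflection_sign_def)
    also have "poly_subst (\<lambda>i. Yc ?n (k - int i)) (P 0) = (-1) ^ ?n * Q (k - int r - 0)"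
      unfolding P_def Q_def by (rule reflect_products(1)[OF f g])
    finally show ?thesis by (cases "even ?n") simp_all
  qed
  ultimately have "(\<Sum>\<mu>\<in>carrier (dihedral ?n). of_int (orientation ?n \<mu>) * \<mu> ?h)
     = (\<Sum>k\<le>?n. P (int k)) - (\<Sum>k\<le>?n. Q (int k + (- int r)))"
    unfolding h sum_dihedral[OF n] by (simp add: orientation_dihedral_op[OF n] sum_negf)
  also have "(\<Sum>k\<le>?n. Q (int k + (- int r))) = (\<Sum>k\<le>?n. Q (int k))"
    by (rule sum_periodic) (simp only: Q_def products_mod)
  finally show ?thesis
    by (simp add: ihara_bracket_cyclic[OF f g] P_def Q_def)
qed

section \<open>The Ihara bracket of functions of words\<close>

text \<open>A polynomial as a function of words of length \<open>r + 1\<close>, extended by zero. The letters range over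
  polynomials; at the word of the variables themselves the function returns the polynomial.\<close>

definition path_fun :: "nat \<Rightarrow> qpoly \<Rightarrow> qpoly list \<Rightarrow> qpoly" where
  "path_fun r f w = (if length w = Suc r then poly_subst (\<lambda>i. w ! i) f else 0)"

lemma concat_prod_window:
  assumes f: "\<And>u. length u \<noteq> Suc r \<Longrightarrow> f u = 0"
  shows "concat_prod f h w = (if r < length w then f (take (Suc r) w) * h (drop (Suc r) w) else 0)"
proof -
  have "concat_prod f h w = (\<Sum>i\<le>length w. if i = Suc r then f (take (Suc r) w) * h (drop (Suc r) w) else 0)"
    unfolding concat_prod_def by (rule sum.cong) (auto simp: f)
  then show ?thesis by simp
qed

lemma path_prod_window:
  assumes f: "\<And>u. length u \<noteq> Suc r \<Longrightarrow> f u = 0"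
  shows "path_prod f h w = (if r < length w then f (take (Suc r) w) * h (drop r w) else 0)"
proof -
  have "path_prod f h w = (\<Sum>i<length w. if i = r then f (take (Suc r) w) * h (drop r w) else 0)"
    unfolding path_prod_def by (rule sum.cong) (auto simp: f)
  then show ?thesis by simp
qed

text \<open>For a function supported on words of length \<open>r + 1\<close> the contracted factor is a window of this length,
  which is determined by its position.\<close>

lemma path_deriv_window:
  assumes f: "\<And>u. length u \<noteq> Suc r \<Longrightarrow> f u = 0"
  shows "path_deriv f h w = (\<Sum>i<length w - r. f (take (Suc r) (drop i w))
    * (h (take (Suc i) w @ drop (i + Suc r) w) - h (take i w @ drop (i + r) w)))"
proof (induction w arbitrary: h)
  case Nil
  show ?case by simp
next
  case (Cons x w)
  have d: "concat_prod f k u = (if r < length u then f (take (Suc r) u) * k (drop (Suc r) u) else 0)" for k u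
    by (rule concat_prod_window) (rule f)
  have s: "path_prod f k u = (if r < length u then f (take (Suc r) u) * k (drop r u) else 0)" for k u
    by (rule path_prod_window) (rule f)
  show ?case
  proof (cases "r \<le> length w")
    case True
    then have "length (x # w) - r = Suc (length w - r)" by simp
    then show ?thesis
      using True unfolding path_deriv.simps d s Cons.IH
      by (simp add: sum.lessThan_Suc_shift algebra_simps del: sum.lessThan_Suc)
  next
    case False
    then show ?thesis
      unfolding path_deriv.simps d s Cons.IH by simp
  qed
qed

text \<open>The path product supplies the window at the beginning of the word contracted to its last letter. This
  cancels the corresponding term of the derivation, and what remains is the range of the second sum in
  the definition of the Ihara operation, which starts at 1.\<close>

lemma path_circ_path_fun:
  assumes f: "f \<in> pspace r" and g: "g \<in> pspace s"
  shows "path_circ (path_fun r f) (path_fun s g) w = path_fun (r + s) (ihara_circ r s f g) w"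
proof (cases "length w = Suc (r + s)")
  case False
  have "path_fun s g (take (Suc i) w @ drop (i + Suc r) w) = 0" "path_fun s g (take i w @ drop (i + r) w) = 0"
    "path_fun s g (drop r w) = 0" if "i + r < length w" for i
    using that False by (auto simp: path_fun_def)
  moreover have "path_fun s g (drop r w) = 0" if "r < length w"
    using that False by (auto simp: path_fun_def)
  ultimately have "path_deriv (path_fun r f) (path_fun s g) w = 0" "path_prod (path_fun r f) (path_fun s g) w = 0"
    by (subst path_deriv_window[where r = r] path_prod_window[where r = r]; force simp: path_fun_def intro!: sum.neutral)+
  then show ?thesis using False by (simp add: path_circ_def path_fun_def)
next
  case True
  let ?f = "\<lambda>i. poly_subst (\<lambda>j. w ! (i + j)) f"
  let ?g = "\<lambda>i. poly_subst (\<lambda>j. if j < i then w ! j else w ! (j + r)) g"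
  have F: "path_fun r f (take (Suc r) (drop i w)) = ?f i" if "i \<le> s" for i
    unfolding path_fun_def using that True
    by (simp, intro poly_subst_cong[OF pspace_polys[OF f]]) simp
  have G: "path_fun s g (take i w @ drop (i + r) w) = ?g i" if "i \<le> Suc s" for i
    unfolding path_fun_def using that True
    by (simp, intro poly_subst_cong[OF pspace_polys[OF g]]) (auto simp: nth_append min_def ac_simps)
  have "path_deriv (path_fun r f) (path_fun s g) w = (\<Sum>i\<le>s. ?f i * (?g (Suc i) - ?g i))"
    using True F G[of "Suc _"] G
    by (subst path_deriv_window[where r = r]) (auto simp: path_fun_def[of r] lessThan_Suc_atMost Suc_diff_le intro!: sum.cong)
  moreover have "path_prod (path_fun r f) (path_fun s g) w = ?f 0 * ?g 0"
    using True F[of 0] G[of 0] by (subst path_prod_window[where r = r]) (auto simp: path_fun_def[of r])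
  moreover have "(\<Sum>i\<le>s. ?f i * ?g i) = ?f 0 * ?g 0 + (\<Sum>i=1..s. ?f i * ?g i)"
    by (simp add: atMost_atLeast0 sum.atLeast_Suc_atMost)
  ultimately have "path_circ (path_fun r f) (path_fun s g) w = (\<Sum>i\<le>s. ?f i * ?g (Suc i)) - (\<Sum>i=1..s. ?f i * ?g i)"
    by (simp only: path_circ_def right_diff_distrib sum_subtractf) simp
  also have "\<dots> = poly_subst (\<lambda>i. w ! i) (ihara_circ r s f g)"
    unfolding ihara_circ_pspace[OF f]
    by (simp add: poly_subst_diff poly_subst_sum poly_subst_mult poly_subst_poly_subst if_distrib
        less_Suc_eq_le atMost_atLeast0 cong: if_cong)
  finally show ?thesis using True by (simp add: path_fun_def)
qed

lemma path_lie_path_fun: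
  assumes "f \<in> pspace r" "g \<in> pspace s"
  shows "path_lie (path_fun r f) (path_fun s g) w = path_fun (r + s) (ihara_bracket r s f g) w"
  using assms by (simp add: path_lie_def path_circ_path_fun ihara_bracket_def path_fun_def poly_subst_diff add.commute)

lemma path_lie_zero: "path_lie (\<lambda>w. 0) h w = 0" "path_lie h (\<lambda>w. 0) w = 0"
  using path_lie_linear(2)[of 0 "\<lambda>w. 0" h w] path_lie_linear(4)[of h 0 "\<lambda>w. 0" w] by simp_all

lemma path_lie_sum:
  "path_lie (\<lambda>w. \<Sum>i\<in>A. f i w) h w = (\<Sum>i\<in>A. path_lie (f i) h w)"
  "path_lie h (\<lambda>w. \<Sum>i\<in>A. f i w) w = (\<Sum>i\<in>A. path_lie h (f i) w)"
  by (induction A rule: infinite_finite_induct) (simp_all add: path_lie_zero path_lie_linear)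

text \<open>All components of an element of the direct sum at once; the component of index \<open>r\<close> is evaluated at
  words of length \<open>r + 1\<close>. The component of index 0 vanishes on the direct sum.\<close>

definition sum_path_fun :: "(nat \<Rightarrow>\<^sub>0 qpoly) \<Rightarrow> qpoly list \<Rightarrow> qpoly" where
  "sum_path_fun F w = (if w = [] then 0 else poly_subst (\<lambda>i. w ! i) (Poly_Mapping.lookup F (length w - 1)))"

lemma sum_path_fun_Nil [simp]: "sum_path_fun F [] = 0"
  by (simp add: sum_path_fun_def)

lemma sum_path_fun_add: "sum_path_fun (F + G) = (\<lambda>w. sum_path_fun F w + sum_path_fun G w)"
  by (rule ext) (simp add: sum_path_fun_def lookup_add poly_subst_add)

lemma sum_path_fun_zero: "sum_path_fun 0 w = 0"
  by (simp add: sum_path_fun_def)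

lemma sum_path_fun_sum: "sum_path_fun (sum F A) w = (\<Sum>i\<in>A. sum_path_fun (F i) w)"
  by (induction A rule: infinite_finite_induct) (simp_all add: sum_path_fun_zero sum_path_fun_add)

lemma sum_path_fun_single: "sum_path_fun (Poly_Mapping.single r f) w = path_fun r f w"
  by (cases w) (auto simp: sum_path_fun_def path_fun_def lookup_single when_def)

lemma sum_path_fun_eq_sum: "sum_path_fun F = (\<lambda>w. \<Sum>r\<in>Poly_Mapping.keys F. path_fun r (Poly_Mapping.lookup F r) w)"
proof
  fix w
  have "sum_path_fun F w = sum_path_fun (\<Sum>r\<in>Poly_Mapping.keys F. Poly_Mapping.single r (Poly_Mapping.lookup F r)) w"
    by (simp add: poly_mapping_as_sum)
  then show "sum_path_fun F w = (\<Sum>r\<in>Poly_Mapping.keys F. path_fun r (Poly_Mapping.lookup F r) w)"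
    by (simp only: sum_path_fun_sum sum_path_fun_single)
qed

lemma pspace_sum_keys: "F \<in> pspace_sum \<Longrightarrow> r \<in> Poly_Mapping.keys F \<Longrightarrow> r \<ge> 1"
  by (cases r) (auto simp: pspace_sum_def in_keys_iff)

lemma pspace_sum_lookup: "F \<in> pspace_sum \<Longrightarrow> r \<in> Poly_Mapping.keys F \<Longrightarrow> Poly_Mapping.lookup F r \<in> pspace r"
  using pspace_sum_keys[of F r] by (auto simp: pspace_sum_def)

lemma sum_path_fun_sum_bracket:
  assumes "F \<in> pspace_sum" "G \<in> pspace_sum"
  shows "sum_path_fun (sum_bracket F G) = path_lie (sum_path_fun F) (sum_path_fun G)"
proof
  fix w
  show "sum_path_fun (sum_bracket F G) w = path_lie (sum_path_fun F) (sum_path_fun G) w"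
    unfolding sum_path_fun_eq_sum[of F] sum_path_fun_eq_sum[of G] path_lie_sum
    unfolding sum_bracket_def sum_path_fun_sum sum_path_fun_single
    by (intro sum.cong refl) (simp add: path_lie_path_fun pspace_sum_lookup assms)
qed

text \<open>The component of index \<open>r\<close> is recovered by evaluating at the word of the variables \<open>y_0, ..., y_r\<close>.
  Together with \<open>sum_path_fun_sum_bracket\<close> this reduces the axioms of a Lie algebra to identities between
  functions of words.\<close>

lemma sum_path_fun_inject:
  assumes "F \<in> pspace_sum" "G \<in> pspace_sum" "\<And>w. sum_path_fun F w = sum_path_fun G w"
  shows "F = G"
proof (rule poly_mapping_eqI)
  have ev: "sum_path_fun H (map Y [0..<Suc r]) = Poly_Mapping.lookup H r" if "H \<in> pspace_sum" for H r
  proof -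
    have p: "Poly_Mapping.lookup H r \<in> polys r"
      using that pspace_polys[of _ r] by (cases r) (auto simp: pspace_sum_def)
    have "sum_path_fun H (map Y [0..<Suc r]) = poly_subst (\<lambda>i. map Y [0..<Suc r] ! i) (Poly_Mapping.lookup H r)"
      by (simp add: sum_path_fun_def)
    also have "\<dots> = poly_subst Y (Poly_Mapping.lookup H r)"
      by (rule poly_subst_cong[OF p]) (simp del: upt_Suc)
    finally show ?thesis by simp
  qed
  show "Poly_Mapping.lookup F r = Poly_Mapping.lookup G r" for r
    using ev[OF assms(1), of r] ev[OF assms(2), of r] assms(3) by simp
qed

lemma lookup_sum_scale: "Poly_Mapping.lookup (sum_scale c F) r = qscale c (Poly_Mapping.lookup F r)"
  by (simp add: sum_scale_def Poly_Mapping.map.rep_eq when_def)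

lemma sum_path_fun_scale: "sum_path_fun (sum_scale c F) = (\<lambda>w. Poly_Mapping.single 0 c * sum_path_fun F w)"
  by (rule ext) (simp add: sum_path_fun_def lookup_sum_scale qscale_def poly_subst_mult poly_subst_single)

interpretation sum_vs: vector_space sum_scale
  by unfold_locales
    (rule poly_mapping_eqI; simp add: lookup_sum_scale lookup_add qscale_add qscale_add_left qscale_qscale)+

lemma pspace_zero [simp]: "0 \<in> pspace r"
  by (simp add: pspace_iff)

lemma pspace_add: "f \<in> pspace r \<Longrightarrow> g \<in> pspace r \<Longrightarrow> f + g \<in> pspace r"
  by (simp add: pspace_iff even_polys_add poly_subst_add distrib_left)

lemma pspace_qscale: "f \<in> pspace r \<Longrightarrow> qscale c f \<in> pspace r"
  by (auto simp: pspace_iff even_polys_iff polys_qscale poly_subst_qscale neg_one_power_cancel)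
    (simp_all add: qscale_def)

lemma subspace_pspace_sum: "sum_vs.subspace pspace_sum"
  by (auto simp: sum_vs.subspace_def pspace_sum_def lookup_add lookup_sum_scale pspace_add pspace_qscale)

lemma single_in_pspace_sum: "r \<ge> 1 \<Longrightarrow> f \<in> pspace r \<Longrightarrow> Poly_Mapping.single r f \<in> pspace_sum"
  by (auto simp: pspace_sum_def lookup_single when_def)

lemma sum_bracket_closed:
  assumes F: "F \<in> pspace_sum" and G: "G \<in> pspace_sum"
  shows "sum_bracket F G \<in> pspace_sum"
  unfolding sum_bracket_def
proof (intro sum_vs.subspace_sum[OF subspace_pspace_sum] single_in_pspace_sum)
  fix r s assume "r \<in> Poly_Mapping.keys F" "s \<in> Poly_Mapping.keys G"
  then show "1 \<le> r + s" "ihara_bracket r s (Poly_Mapping.lookup F r) (Poly_Mapping.lookup G s) \<in> pspace (r + s)"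
    using pspace_sum_keys[OF F, of r] by (simp_all add: bracket_pspace pspace_sum_lookup F G)
qed

lemma pspace_sum_add: "F \<in> pspace_sum \<Longrightarrow> G \<in> pspace_sum \<Longrightarrow> F + G \<in> pspace_sum"
  by (rule sum_vs.subspace_add[OF subspace_pspace_sum])

lemma pspace_sum_scale: "F \<in> pspace_sum \<Longrightarrow> sum_scale c F \<in> pspace_sum"
  by (rule sum_vs.subspace_scale[OF subspace_pspace_sum])

lemma pspace_sum_zero: "0 \<in> pspace_sum"
  by (rule sum_vs.subspace_0[OF subspace_pspace_sum])

lemma lie_algebra_pspace_sum: "lie_algebra sum_scale pspace_sum sum_bracket"
proof
  note cl = sum_bracket_closed pspace_sum_add pspace_sum_scale pspace_sum_zero
  note H = sum_path_fun_sum_bracket sum_path_fun_add sum_path_fun_scale sum_path_fun_zero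
  show "sum_vs.subspace pspace_sum" by (rule subspace_pspace_sum)
  fix x y z :: "nat \<Rightarrow>\<^sub>0 qpoly" and c
  assume x: "x \<in> pspace_sum"
  show "sum_bracket x x = 0"
    by (rule sum_path_fun_inject) (simp_all add: cl H x path_lie_def)
  assume y: "y \<in> pspace_sum"
  show "sum_bracket x y \<in> pspace_sum" by (simp add: cl x y)
  show "sum_bracket (sum_scale c x) y = sum_scale c (sum_bracket x y)"
    "sum_bracket x (sum_scale c y) = sum_scale c (sum_bracket x y)"
    by (rule sum_path_fun_inject; simp add: cl H x y path_lie_linear)+
  assume z: "z \<in> pspace_sum"
  show "sum_bracket (x + y) z = sum_bracket x z + sum_bracket y z"
    "sum_bracket x (y + z) = sum_bracket x y + sum_bracket x z"
    by (rule sum_path_fun_inject; simp add: cl H x y z path_lie_linear)+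
  show "sum_bracket x (sum_bracket y z) + sum_bracket y (sum_bracket z x) + sum_bracket z (sum_bracket x y) = 0"
    by (rule sum_path_fun_inject) (simp_all add: cl H x y z path_lie_jacobi)
qed

text \<open>The conditions that define the space are compatible with the grading, because they only involve
  substitutions of linear forms.\<close>

lemma pspace_hom_component:
  assumes "f \<in> pspace r"
  shows "hom_component d f \<in> pspace r"
proof -
  have sgn: "hom_component d ((-1) ^ r * p) = (-1) ^ r * hom_component d p" for p
    by (cases "even r") (simp_all add: hom_component_uminus)
  have "Poly_Mapping.keys (hom_component d f) \<subseteq> Poly_Mapping.keys f"
    by (auto simp: in_keys_iff lookup_hom_component split: if_splits)
  then have "hom_component d f \<in> polys r" using pspace_polys[OF assms] by (auto simp: polys_def)
  moreover have "poly_subst (\<lambda>i. - Y i) (hom_component d f) = hom_component d (poly_subst (\<lambda>i. - Y i) f)"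
    by (rule hom_component_subst[symmetric]) (intro homogeneous_uminus homogeneous_Y)
  moreover have "(-1) ^ r * poly_subst (\<lambda>i. Y (r - i)) (hom_component d f)
      = hom_component d ((-1) ^ r * poly_subst (\<lambda>i. Y (r - i)) f)"
    unfolding sgn by (rule arg_cong[OF hom_component_subst[symmetric]]) (rule homogeneous_Y)
  moreover have "(-1) ^ r * poly_subst (\<lambda>i. if i = 0 then Y 0 else Y (r + 1 - i)) (hom_component d f)
      = hom_component d ((-1) ^ r * poly_subst (\<lambda>i. if i = 0 then Y 0 else Y (r + 1 - i)) f)"
    unfolding sgn by (rule arg_cong[OF hom_component_subst[symmetric]]) (simp add: homogeneous_Y del: One_nat_def)
  ultimately show ?thesis
    using assms unfolding pspace_iff even_polys_iff by (simp only: hom_component_uminus simp_thms)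
qed

section \<open>The bigrading\<close>

text \<open>The projection to a bihomogeneous component. It is additive, so it determines the summands in any
  decomposition into elements of the components.\<close>

definition bihom_proj :: "nat \<times> nat \<Rightarrow> (nat \<Rightarrow>\<^sub>0 qpoly) \<Rightarrow> (nat \<Rightarrow>\<^sub>0 qpoly)" where
  "bihom_proj = (\<lambda>(d, r) F. Poly_Mapping.single r (hom_component d (Poly_Mapping.lookup F r)))"

lemma bihom_proj_add: "bihom_proj i (F + G) = bihom_proj i F + bihom_proj i G"
  by (cases i) (simp add: bihom_proj_def lookup_add hom_component_add single_add)

lemma bihom_proj_zero: "bihom_proj i 0 = 0"
  by (cases i) (simp add: bihom_proj_def)

lemma bihom_proj_sum: "bihom_proj i (sum F A) = (\<Sum>j\<in>A. bihom_proj i (F j))"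
  by (induction A rule: infinite_finite_induct) (simp_all add: bihom_proj_add bihom_proj_zero)

lemma bihom_proj_component:
  assumes "F \<in> pspace_component j"
  shows "bihom_proj i F = (if i = j then F else 0)"
proof -
  obtain d r e s where i: "i = (d, r)" and j: "j = (e, s)" by fastforce
  have F: "Poly_Mapping.keys F \<subseteq> {s}" "homogeneous e (Poly_Mapping.lookup F s)"
    using assms by (auto simp: j pspace_component_def)
  then have "Poly_Mapping.lookup F r = 0" if "r \<noteq> s"
    using that by (auto simp: in_keys_iff)
  moreover have "Poly_Mapping.single s (Poly_Mapping.lookup F s) = F"
    using poly_mapping_as_sum[of "{s}" F] F by simp
  ultimately show ?thesis
    by (cases "r = s") (auto simp: i j bihom_proj_def hom_component_homogeneous[OF F(2)])
qed

lemma bihom_proj_in_component: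
  assumes "F \<in> pspace_sum"
  shows "bihom_proj i F \<in> pspace_component i"
proof -
  obtain d r where i: "i = (d, r)" by fastforce
  have "Poly_Mapping.single r (hom_component d (Poly_Mapping.lookup F r)) \<in> pspace_sum"
    using assms pspace_hom_component[of _ r d]
    by (auto simp: pspace_sum_def lookup_single when_def)
  then show ?thesis
    by (auto simp: i bihom_proj_def pspace_component_def homogeneous_hom_component)
qed

lemma sum_bihom_proj:
  assumes "F \<in> pspace_sum"
  shows "finite {i. bihom_proj i F \<noteq> 0}" and "F = (\<Sum>i | bihom_proj i F \<noteq> 0. bihom_proj i F)"
proof -
  let ?D = "\<Union>r\<in>Poly_Mapping.keys F. mono_degree ` Poly_Mapping.keys (Poly_Mapping.lookup F r)"
  let ?S = "?D \<times> Poly_Mapping.keys F"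
  have fin: "finite ?S" "finite ?D" by auto
  have z: "bihom_proj i F = 0" if i: "i \<notin> ?S" for i
  proof -
    obtain d r where dr: "i = (d, r)" by fastforce
    have "hom_component d (Poly_Mapping.lookup F r) = 0"
    proof (rule poly_mapping_eqI, rule ccontr)
      fix m
      assume "Poly_Mapping.lookup (hom_component d (Poly_Mapping.lookup F r)) m \<noteq> Poly_Mapping.lookup 0 m"
      then have "d = mono_degree m" "m \<in> Poly_Mapping.keys (Poly_Mapping.lookup F r)" "r \<in> Poly_Mapping.keys F"
        by (auto simp: lookup_hom_component in_keys_iff split: if_splits)
      with i show False by (auto simp: dr)
    qed
    then show ?thesis by (simp add: bihom_proj_def dr)
  qed
  then show fin': "finite {i. bihom_proj i F \<noteq> 0}" by (intro finite_subset[OF _ fin(1)]) auto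
  have single_sum: "Poly_Mapping.single r (sum p A) = (\<Sum>i\<in>A. Poly_Mapping.single r (p i))" for r p and A :: "nat set"
    by (induction A rule: infinite_finite_induct) (simp_all add: single_add)
  have "(\<Sum>i | bihom_proj i F \<noteq> 0. bihom_proj i F) = (\<Sum>i\<in>?S. bihom_proj i F)"
    using z by (intro sum.mono_neutral_left fin) auto
  also have "\<dots> = (\<Sum>r\<in>Poly_Mapping.keys F. \<Sum>d\<in>?D. bihom_proj (d, r) F)"
    by (subst sum.swap) (rule sum.cartesian_product')
  also have "\<dots> = (\<Sum>r\<in>Poly_Mapping.keys F. Poly_Mapping.single r (Poly_Mapping.lookup F r))"
  proof (rule sum.cong[OF refl])
    fix r assume "r \<in> Poly_Mapping.keys F"
    then have "(\<Sum>d\<in>?D. hom_component d (Poly_Mapping.lookup F r)) = Poly_Mapping.lookup F r"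
      by (intro sum_hom_component fin) auto
    then show "(\<Sum>d\<in>?D. bihom_proj (d, r) F) = Poly_Mapping.single r (Poly_Mapping.lookup F r)"
      by (simp only: bihom_proj_def prod.case single_sum[symmetric])
  qed
  also have "\<dots> = F" by (rule poly_mapping_as_sum) auto
  finally show "F = (\<Sum>i | bihom_proj i F \<noteq> 0. bihom_proj i F)" by (rule sym)
qed

lemma component_subset_pspace_sum: "pspace_component i \<subseteq> pspace_sum"
  by (cases i) (auto simp: pspace_component_def)

lemma subspace_component: "sum_vs.subspace (pspace_component i)"
proof -
  obtain d r where i: "i = (d, r)" by fastforce
  have "Poly_Mapping.keys (F + G) \<subseteq> {r}" if "Poly_Mapping.keys F \<subseteq> {r}" "Poly_Mapping.keys G \<subseteq> {r}"
    for F G :: "nat \<Rightarrow>\<^sub>0 qpoly"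
    using that keys_add[of F G] by blast
  moreover have "Poly_Mapping.keys (sum_scale c F) \<subseteq> Poly_Mapping.keys F" for c F
    by (auto simp: in_keys_iff lookup_sum_scale)
  ultimately show ?thesis
    unfolding sum_vs.subspace_def i pspace_component_def
    by (auto simp: pspace_sum_zero pspace_sum_add pspace_sum_scale lookup_add lookup_sum_scale
        homogeneous_add homogeneous_qscale subset_iff)
qed

lemma bracket_component:
  assumes x: "x \<in> pspace_component i" and y: "y \<in> pspace_component j"
  shows "sum_bracket x y \<in> pspace_component (i + j)"
proof -
  obtain d r e s where i: "i = (d, r)" and j: "j = (e, s)" by fastforce
  have xs: "x \<in> pspace_sum" "y \<in> pspace_sum"
    by (rule subsetD[OF component_subset_pspace_sum]; fact)+
  have kx: "Poly_Mapping.keys x \<subseteq> {r}" "homogeneous d (Poly_Mapping.lookup x r)"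
    and ky: "Poly_Mapping.keys y \<subseteq> {s}" "homogeneous e (Poly_Mapping.lookup y s)"
    using x y by (auto simp: i j pspace_component_def)
  show ?thesis
  proof (cases "Poly_Mapping.keys x = {} \<or> Poly_Mapping.keys y = {}")
    case True
    then have "sum_bracket x y = 0" by (auto simp: sum_bracket_def)
    then show ?thesis using sum_vs.subspace_0[OF subspace_component] by simp
  next
    case False
    then have k: "Poly_Mapping.keys x = {r}" "Poly_Mapping.keys y = {s}" 
      using subset_singletonD[OF kx(1)] subset_singletonD[OF ky(1)] by blast+
    have "sum_bracket x y =
      Poly_Mapping.single (r + s) (ihara_bracket r s (Poly_Mapping.lookup x r) (Poly_Mapping.lookup y s))"
      by (simp add: sum_bracket_def k)
    moreover have "homogeneous (d + e) (ihara_bracket r s (Poly_Mapping.lookup x r) (Poly_Mapping.lookup y s))"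
      by (intro bracket_homogeneous kx ky pspace_sum_lookup xs) (simp_all add: k)
    ultimately show ?thesis
      using sum_bracket_closed[OF xs] by (auto simp: i j pspace_component_def)
  qed
qed

lemma graded_lie_algebra_pspace_sum:
  "graded_lie_algebra sum_scale pspace_sum sum_bracket pspace_component"
proof (intro graded_lie_algebra.intro lie_algebra_pspace_sum graded_lie_algebra_axioms.intro)
  fix x assume x: "x \<in> pspace_sum"
  show "\<exists>!c. finite {i. c i \<noteq> 0} \<and> (\<forall>i. c i \<in> pspace_component i) \<and> x = (\<Sum>i | c i \<noteq> 0. c i)"
  proof (rule ex1I)
    show "finite {i. bihom_proj i x \<noteq> 0} \<and> (\<forall>i. bihom_proj i x \<in> pspace_component i) \<and> x = (\<Sum>i | bihom_proj i x \<noteq> 0. bihom_proj i x)"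
      using sum_bihom_proj[OF x] bihom_proj_in_component[OF x] by blast
    fix c assume c: "finite {i. c i \<noteq> 0} \<and> (\<forall>i. c i \<in> pspace_component i) \<and> x = (\<Sum>i | c i \<noteq> 0. c i)"
    show "c = (\<lambda>i. bihom_proj i x)"
    proof
      fix i
      have "bihom_proj i x = (\<Sum>j | c j \<noteq> 0. bihom_proj i (c j))"
        using c by (metis bihom_proj_sum)
      also have "\<dots> = (\<Sum>j | c j \<noteq> 0. if i = j then c j else 0)"
        using c by (intro sum.cong refl bihom_proj_component) auto
      also have "\<dots> = c i" using c by simp
      finally show "c i = bihom_proj i x" by simp
    qed
  qed
qed (use subspace_component component_subset_pspace_sum bracket_component in auto)

theorem proposition6p5:
  shows "(\<forall>r\<ge>1. \<forall>s\<ge>1. \<forall>f\<in>pspace r. \<forall>g\<in>pspace s.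
           ihara_bracket r s f g =
             - (\<Sum>\<mu>\<in>carrier (dihedral (r + s)).
                  of_int (orientation (r + s) \<mu>) * \<mu> (f * poly_subst (\<lambda>j. Y (r + j)) g))
           \<and> ihara_bracket r s f g \<in> pspace (r + s))
         \<and> graded_lie_algebra sum_scale pspace_sum sum_bracket pspace_component"
  using bracket_dihedral_sum bracket_pspace graded_lie_algebra_pspace_sum by blast

end
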